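(* For any positive integer $n$ and $0\le j\le n-1$, the triple $\left(\mathtt{Code}_{n,j},\,C_n,\,a_{n,j}(q)\right)$ exhibits the cyclic sieving phenomenon.
   Context: Cyclic sieving phenomenon: let $C=\langle c\rangle$ be a finite cyclic group acting on a finite set $X$, let $X(q)$ be a polynomial with nonnegative integer coefficients, and let $\omega=e^{2\pi i/|C|}$. The triple $(X,C,X(q))$ exhibits the cyclic sieving phenomenon if $|\{x\in X:c^r\cdot x=x\}|=X(\omega^r)$ for all $r\ge0$. $C_n=\langle c_n\rangle\le\mathfrak{S}_n$ with $c_n=(1\,2\,\cdots\,n)$. A Stembridge code of length $n$ is a pair $(\alpha,f)$ where $\alpha=\alpha_1\cdots\alpha_n$ is a sequence over $\{0,1,2,\dots\}$ such that, with $m(\alpha)$ the maximum number appearing in $\alpha$, each $k\in\{1,\dots,m(\alpha)\}$ occurs at least twice in $\alpha$; and for each such $k$ exactly one occurrence of $k$ other than the first is marked, with $f(k)$ the number of occurrences of $k$ to the left of the marked one (so $1\le f(k)\le(\text{number of occurrences of }k)-1$). The letter $0$ may occur any number of times. The index is $\mathrm{ind}(\alpha,f)=\sum_{k=1}^{m(\alpha)}f(k)$, and $\mathtt{Code}_{n,j}$ is the set of Stembridge codes of length $n$ and index $j$. $C_n$ acts by $\sigma\cdot(\alpha_1\cdots\alpha_n,f)=(\alpha_{\sigma(1)}\cdots\alpha_{\sigma(n)},f)$. $a_{n,j}(q)$ is the coefficient of $t^j$ in the $q$-Eulerian polynomial $A_n(q,t)=\sum_{\sigma\in\mathfrak S_n}q^{\mathrm{maj}(\sigma)-\mathrm{exc}(\sigma)}t^{\mathrm{exc}(\sigma)}$,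 where $\mathrm{maj}(\sigma)=\sum_{i:\sigma_i>\sigma_{i+1}}i$ and $\mathrm{exc}(\sigma)=|\{i:\sigma_i>i\}|$. *)

theory Defs
  imports
    "HOL-Library.FuncSet"
    "HOL-Computational_Algebra.Polynomial"
    "HOL-Algebra.Elementary_Groups"
    "HOL-Algebra.Group_Action"
    "HOL-Algebra.Sym_Groups"
    "HOL-Combinatorics.Cycles"
    "HOL-Analysis.Complex_Transcendental"
begin

section \<open>Cyclic sieving\<close>

text \<open>Nonnegativity of the coefficients of the polynomial is built into the type \<^typ>\<open>nat poly\<close>.
  The generator \<open>c\<close> is part of the data: it is matched with the root of unity
  \<open>exp (2 \<pi> \<i> / |C|)\<close>.\<close>

definition cyclic_sieving ::
  "('g, 'b) monoid_scheme \<Rightarrow> 'g \<Rightarrow> 'x set \<Rightarrow> ('g \<Rightarrow> 'x \<Rightarrow> 'x) \<Rightarrow> nat poly \<Rightarrow> bool" where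
  "cyclic_sieving C c X \<phi> P \<longleftrightarrow>
     group C \<and> finite (carrier C) \<and> c \<in> carrier C \<and> subgroup_generated C {c} = C \<and>
     finite X \<and> group_action C X \<phi> \<and>
     (\<forall>r::nat. of_nat (card {x \<in> X. \<phi> (c [^]\<^bsub>C\<^esub> r) x = x}) =
        poly (map_poly of_nat P) (exp (2 * of_real pi * \<i> / of_nat (order C)) ^ r :: complex))"

section \<open>The cyclic group generated by the long cycle\<close>

definition long_cycle :: "nat \<Rightarrow> nat \<Rightarrow> nat" where
  "long_cycle n = cycle_of_list [1..<Suc n]"

definition cycle_group :: "nat \<Rightarrow> (nat \<Rightarrow> nat) monoid" where
  "cycle_group n = subgroup_generated (sym_group n) {long_cycle n}"

section \<open>Stembridge codes\<close>

text \<open>A sequence \<open>\<alpha>\<^sub>1 \<dots> \<alpha>\<^sub>n\<close> is an extensional function on \<open>{1..n}\<close>.\<close>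

definition max_letter :: "nat \<Rightarrow> (nat \<Rightarrow> nat) \<Rightarrow> nat" where
  "max_letter n \<alpha> = Max (\<alpha> ` {1..n})"

definition occurrences :: "nat \<Rightarrow> (nat \<Rightarrow> nat) \<Rightarrow> nat \<Rightarrow> nat set" where
  "occurrences n \<alpha> k = {i \<in> {1..n}. \<alpha> i = k}"

text \<open>The marking is given by the function \<open>f\<close>, where \<open>f k\<close> is the number of occurrences of \<open>k\<close> to
  the left of the marked one; lemma \<open>mark_values\<close> below shows that marking an occurrence other than
  the first amounts to choosing \<open>f k\<close> in the range used here.  Extensionality of \<open>f\<close> (through
  \<^const>\<open>PiE\<close>) ensures that each code is represented exactly once.\<close>

definition stembridge_codes :: "nat \<Rightarrow> ((nat \<Rightarrow> nat) \<times> (nat \<Rightarrow> nat)) set" where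
  "stembridge_codes n =
     {(\<alpha>, f). \<alpha> \<in> {1..n} \<rightarrow>\<^sub>E UNIV \<and>
        (\<forall>k \<in> {1..max_letter n \<alpha>}. 2 \<le> card (occurrences n \<alpha> k)) \<and>
        f \<in> (\<Pi>\<^sub>E k \<in> {1..max_letter n \<alpha>}. {1..card (occurrences n \<alpha> k) - 1})}"

definition code_index :: "nat \<Rightarrow> (nat \<Rightarrow> nat) \<times> (nat \<Rightarrow> nat) \<Rightarrow> nat" where
  "code_index n = (\<lambda>(\<alpha>, f). \<Sum>k = 1..max_letter n \<alpha>. f k)"

definition Code :: "nat \<Rightarrow> nat \<Rightarrow> ((nat \<Rightarrow> nat) \<times> (nat \<Rightarrow> nat)) set" where
  "Code n j = {x \<in> stembridge_codes n. code_index n x = j}"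

text \<open>The restriction to \<open>Code n j\<close> only serves the convention of \<^const>\<open>BijGroup\<close> that
  permutations of a set are extensional functions.\<close>

definition code_action ::
  "nat \<Rightarrow> nat \<Rightarrow> (nat \<Rightarrow> nat) \<Rightarrow> (nat \<Rightarrow> nat) \<times> (nat \<Rightarrow> nat) \<Rightarrow> (nat \<Rightarrow> nat) \<times> (nat \<Rightarrow> nat)" where
  "code_action n j \<sigma> = restrict (\<lambda>(\<alpha>, f). (\<alpha> \<circ> \<sigma>, f)) (Code n j)"

lemma mark_values:
  fixes A :: "nat set"
  assumes "finite A"
  shows "(\<lambda>p. card {i \<in> A. i < p}) ` {p \<in> A. \<exists>i \<in> A. i < p} = {1..card A - 1}"
proof -
  let ?g = "\<lambda>p. card {i \<in> A. i < p}"
  have inj: "inj_on ?g A"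
  proof (rule linorder_inj_onI')
    fix p q assume "p \<in> A" "q \<in> A" "p < q"
    then have "{i \<in> A. i < p} \<subset> {i \<in> A. i < q}" by auto
    then have "?g p < ?g q" using assms by (intro psubset_card_mono) auto
    then show "?g p \<noteq> ?g q" by simp
  qed
  have lt: "?g p < card A" if "p \<in> A" for p
    using assms that by (intro psubset_card_mono) auto
  have "?g ` A = {..<card A}"
    using inj lt by (intro card_subset_eq) (auto simp: card_image)
  moreover have "{p \<in> A. \<exists>i \<in> A. i < p} = {p \<in> A. 1 \<le> ?g p}"
    using assms by (auto simp: Suc_le_eq card_gt_0_iff)
  ultimately have "?g ` {p \<in> A. \<exists>i \<in> A. i < p} = {m. 1 \<le> m \<and> m < card A}"
    by (auto simp: set_eq_iff image_iff) (metis lessThan_iff imageE)+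
  then show ?thesis by auto
qed

section \<open>The q-Eulerian polynomials\<close>

definition maj :: "nat \<Rightarrow> (nat \<Rightarrow> nat) \<Rightarrow> nat" where
  "maj n \<sigma> = \<Sum>{i \<in> {1..<n}. \<sigma> i > \<sigma> (Suc i)}"

definition exc :: "nat \<Rightarrow> (nat \<Rightarrow> nat) \<Rightarrow> nat" where
  "exc n \<sigma> = card {i \<in> {1..n}. \<sigma> i > i}"

text \<open>The subtraction of natural numbers below never truncates.\<close>

lemma exc_le_maj:
  assumes "\<sigma> permutes {1..n}"
  shows "exc n \<sigma> \<le> maj n \<sigma>"
proof -
  let ?D = "{i \<in> {1..<n}. \<sigma> i > \<sigma> (Suc i)}"
  have bound: "i \<le> \<Sum>?D" if i: "i \<in> {1..n}" "\<sigma> i > i" for i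
  proof (rule ccontr)
    assume less: "\<not> i \<le> \<Sum>?D"
    have noD: "k \<notin> ?D" if "i \<le> k" for k
      using member_le_sum[of k ?D "\<lambda>x. x"] that less by auto
    have "k \<le> n \<longrightarrow> k < \<sigma> k" if "i \<le> k" for k
      using that
    proof (induction k rule: dec_induct)
      case base
      then show ?case using i by simp
    next
      case (step k)
      show ?case
      proof
        assume "Suc k \<le> n"
        then have "\<sigma> k \<le> \<sigma> (Suc k)" "k < \<sigma> k" using noD[of k] step i by auto
        moreover have "\<sigma> k \<noteq> \<sigma> (Suc k)"
          using permutes_inj[OF assms] by (metis injD n_not_Suc_n)
        ultimately show "Suc k < \<sigma> (Suc k)" by simp
      qed
    qed
    then have "n < \<sigma> n" using i by auto
    moreover have "\<sigma> n \<in> {1..n}" using permutes_in_image[OF assms, of n] i by auto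
    ultimately show False by simp
  qed
  have "{i \<in> {1..n}. \<sigma> i > i} \<subseteq> {1..\<Sum>?D}" using bound by auto
  then show ?thesis unfolding exc_def maj_def
    by (metis (no_types, lifting) card_mono finite_atLeastAtMost card_atLeastAtMost diff_Suc_1)
qed

text \<open>The outer variable is \<open>t\<close>, the inner one is \<open>q\<close>.\<close>

definition q_Eulerian :: "nat \<Rightarrow> nat poly poly" where
  "q_Eulerian n = (\<Sum>\<sigma> | \<sigma> permutes {1..n}. monom (monom 1 (maj n \<sigma> - exc n \<sigma>)) (exc n \<sigma>))"

definition q_Eulerian_coeff :: "nat \<Rightarrow> nat \<Rightarrow> nat poly" where
  "q_Eulerian_coeff n j = coeff (q_Eulerian n) j"

end

theory Submission
  imports
    Defs
    "HOL-Library.Poly_Mapping"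
    "HOL-Library.Multiset"
    "HOL-Number_Theory.Cong"
begin

text \<open>
  The polynomial \<open>a\<^sub>n\<^sub>,\<^sub>j(q)\<close> is the generating function of the major index of \<open>\<alpha>\<close> over all codes
  \<open>(\<alpha>, f)\<close> of index \<open>j\<close>.  Since \<open>maj \<sigma> - exc \<sigma>\<close> is the sum of the descents of the word \<open>\<sigma>\<close> with
  barred excedances, by inclusion-exclusion it suffices to compare, for each \<open>S \<subseteq> {1..<n}\<close>, the objects
  whose descent set lies in \<open>S\<close>.  Let \<open>S\<close> cut the positions into blocks of sizes \<open>\<mu>\<close>.

  A permutation with barred descents in \<open>S\<close> is determined by recording for each value the block it comes
  from and whether it is an excedance value.  Hence the permutations, weighted by \<open>t ^ exc\<close>, are counted by
  the coefficient \<open>N\<^sub>\<mu>\<close> of \<open>x\<^sup>\<mu>\<close> in \<open>\<Prod>\<^sub>C (L\<^sub>C - t x\<^sub>C) L\<^sub>C ^ (\<mu>\<^sub>C - 1)\<close> with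
  \<open>L\<^sub>C = t \<Sum>\<^sub>B\<^sub>\<le>\<^sub>C x\<^sub>B + \<Sum>\<^sub>B\<^sub>\<ge>\<^sub>C x\<^sub>B\<close>.  Let \<open>M\<^sub>\<mu>\<close> be the coefficient of \<open>x\<^sup>\<mu>\<close> in \<open>\<Prod>\<^sub>C L\<^sub>C ^ \<mu>\<^sub>C\<close>.
  Expanding \<open>L\<^sub>C ^ \<mu>\<^sub>C\<close> by powers of \<open>t x\<^sub>C\<close> gives \<open>M\<^sub>\<mu> = \<Sum>\<^sub>\<nu> t ^ |\<nu>| N\<^sub>\<mu>\<^sub>-\<^sub>\<nu>\<close>; expanding it by powers of
  \<open>x\<^sub>C\<close> and using \<open>\<Prod>\<^sub>C (L\<^sub>C - x\<^sub>C) = t \<Prod>\<^sub>C (L\<^sub>C - t x\<^sub>C)\<close> gives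
  \<open>M\<^sub>\<mu> = t \<Sum>\<^sub>\<nu> N\<^sub>\<mu>\<^sub>-\<^sub>\<nu> + (1 - t)\<close>.  The resulting recurrence for \<open>N\<close> is the one obtained by deleting the
  largest letter of a code.

  Let \<open>\<zeta>\<close> be a primitive \<open>d\<close>-th root of unity with \<open>d\<close> dividing \<open>n\<close>, and cut the positions into blocks
  of length \<open>d\<close>.  Rotating one block changes \<open>maj \<alpha>\<close> modulo \<open>d\<close> by the number of cyclic descents of
  that block, which is strictly between \<open>0\<close> and \<open>d\<close> unless the block is constant.  So the sum of
  \<open>\<zeta> ^ maj \<alpha>\<close> over the codes counts those that are constant on all blocks, and a permutation of the
  positions turns these into the codes fixed by \<open>c\<^sup>r\<close>, where \<open>d = n / gcd n r\<close>.
\<close>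

section \<open>Coefficients of products of linear forms\<close>

lemma update_eq_add_single:
  fixes f :: "'a \<Rightarrow>\<^sub>0 'b::monoid_add"
  assumes "a \<notin> Poly_Mapping.keys f"
  shows "Poly_Mapping.update a b f = f + Poly_Mapping.single a b"
  using assms
  by (intro poly_mapping_eqI) (auto simp: lookup_update lookup_add lookup_single not_in_keys_iff_lookup_eq_zero when_def)

text \<open>Polynomials are finitely supported maps on exponent multisets, so multiplying monomials
  adds multisets. Since \<open>\<rho> - k\<close> truncates, a coefficient survives the shift only
  if \<open>k\<close> is a submultiset of \<open>\<rho>\<close>.\<close>

lemma lookup_single_mult:
  fixes p :: "'c multiset \<Rightarrow>\<^sub>0 'a::comm_ring_1"
  shows "Poly_Mapping.lookup (Poly_Mapping.single k a * p) \<rho> =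
    (if k \<subseteq># \<rho> then a * Poly_Mapping.lookup p (\<rho> - k) else 0)"
proof (induction p rule: update_induct)
  case const
  then show ?case by simp
next
  case (update f m b)
  have "k + m = \<rho> \<longleftrightarrow> k \<subseteq># \<rho> \<and> m = \<rho> - k"
    by (auto simp: subset_mset.add_diff_inverse)
  then show ?case
    using update by (auto simp: update_eq_add_single distrib_left lookup_add mult_single lookup_single when_def)
qed

text \<open>Equality modulo the ideal generated by the variables outside \<open>V\<close>.\<close>

definition agree_on :: "'c set \<Rightarrow> ('c multiset \<Rightarrow>\<^sub>0 'a) \<Rightarrow> ('c multiset \<Rightarrow>\<^sub>0 'a::comm_ring_1) \<Rightarrow> bool" where
  "agree_on V p q \<longleftrightarrow> (\<forall>\<rho>. set_mset \<rho> \<subseteq> V \<longrightarrow> Poly_Mapping.lookup p \<rho> = Poly_Mapping.lookup q \<rho>)"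

lemma agree_on_refl [simp]: "agree_on V p p"
  by (simp add: agree_on_def)

text \<open>Removing elements from a multiset over \<open>V\<close> leaves one over
  \<open>V\<close>, so there the coefficients of the product depend only on coefficients where
  \<open>p\<close> and \<open>p'\<close> agree.\<close>

lemma agree_on_mult_right:
  assumes "agree_on V p p'"
  shows "agree_on V (p * q) (p' * q)"
proof (induction q rule: update_induct)
  case const
  then show ?case by simp
next
  case (update f m b)
  have "set_mset (\<rho> - m) \<subseteq> V" if "set_mset \<rho> \<subseteq> V" for \<rho>
    using that by (meson in_diffD subset_iff)
  with update assms show ?case
    by (simp add: agree_on_def update_eq_add_single distrib_left lookup_add lookup_single_mult
      mult.commute[of _ "Poly_Mapping.single m b"])
qed

lemma agree_on_mult:
  assumes "agree_on V p p'" "agree_on V q q'"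
  shows "agree_on V (p * q) (p' * q')"
  using agree_on_mult_right[OF assms(1), of q] agree_on_mult_right[OF assms(2), of p']
  by (simp add: agree_on_def mult.commute)

lemma agree_on_prod:
  assumes "\<And>i. i \<in> I \<Longrightarrow> agree_on V (p i) (q i)"
  shows "agree_on V (\<Prod>i\<in>I. p i) (\<Prod>i\<in>I. q i)"
  using assms by (induction I rule: infinite_finite_induct) (auto intro: agree_on_mult)

lemma agree_on_power: "agree_on V p q \<Longrightarrow> agree_on V (p ^ k) (q ^ k)"
  by (induction k) (auto intro: agree_on_mult)

lemma agree_on_diff: "agree_on V p p' \<Longrightarrow> agree_on V q q' \<Longrightarrow> agree_on V (p - q) (p' - q')"
  by (simp add: agree_on_def lookup_minus)

lemma agree_on_add: "agree_on V p p' \<Longrightarrow> agree_on V q q' \<Longrightarrow> agree_on V (p + q) (p' + q')"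
  by (simp add: agree_on_def lookup_add)

lemma agree_on_linear:
  assumes "finite U" "V \<subseteq> U"
  shows "agree_on V (\<Sum>B\<in>{B \<in> U. Q B}. Poly_Mapping.single {#B#} a)
                    (\<Sum>B\<in>{B \<in> V. Q B}. Poly_Mapping.single {#B#} a)"
proof -
  have "(\<Sum>B\<in>{B \<in> U. Q B}. (a when {#B#} = \<rho>)) = (\<Sum>B\<in>{B \<in> V. Q B}. (a when {#B#} = \<rho>))"
    if "set_mset \<rho> \<subseteq> V" for \<rho>
    using assms that by (intro sum.mono_neutral_right) (auto simp: when_def)
  then show ?thesis by (simp add: agree_on_def lookup_sum lookup_single)
qed

section \<open>Two expansions of a product of powers of linear forms\<close>

definition block_factor :: "'a::comm_ring_1 \<Rightarrow> 'a \<Rightarrow> nat \<Rightarrow> 'a" where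
  "block_factor L y k = (if k = 0 then 1 else (L - y) * L ^ (k - 1))"

text \<open>Iterate \<open>L ^ Suc m = (L - y) * L ^ m + y * L ^ m\<close>. The last summand is
  \<open>y ^ m\<close> because an empty block contributes the factor 1. As \<open>y\<close> is free,
  the same power can be expanded both by \<open>t * x_C\<close> and by \<open>x_C\<close>.\<close>

lemma power_eq_sum_block_factor:
  "L ^ m = (\<Sum>k\<le>m. y ^ k * block_factor L y (m - k))"
proof (induction m)
  case 0
  then show ?case by (simp add: block_factor_def)
next
  case (Suc m)
  have "(\<Sum>k\<le>Suc m. y ^ k * block_factor L y (Suc m - k)) = (L - y) * L ^ m + y * (\<Sum>k\<le>m. y ^ k * block_factor L y (m - k))"
    by (subst sum.atMost_Suc_shift) (simp add: block_factor_def sum_distrib_left mult.assoc)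
  also have "\<dots> = L ^ Suc m"
    by (simp flip: Suc.IH add: algebra_simps)
  finally show ?case by simp
qed

text \<open>Distributing a product of sums yields one exponent for each variable in
  \<open>U\<close>; this turns such exponent functions into submultisets of
  \<open>\<mu>\<close>.\<close>

lemma bij_betw_restrict_count:
  assumes "finite U" "set_mset \<mu> \<subseteq> U"
  shows "bij_betw (\<lambda>\<nu>. restrict (count \<nu>) U) {\<nu>. \<nu> \<subseteq># \<mu>} (\<Pi>\<^sub>E C\<in>U. {..count \<mu> C})"
proof (rule bij_betwI')
  fix \<nu> \<nu>' assume "\<nu> \<in> {\<nu>. \<nu> \<subseteq># \<mu>}" "\<nu>' \<in> {\<nu>. \<nu> \<subseteq># \<mu>}"
  then have supp: "set_mset \<nu> \<subseteq> U" "set_mset \<nu>' \<subseteq> U"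
    using assms(2) by (auto dest: mset_subset_eqD)
  show "(restrict (count \<nu>) U = restrict (count \<nu>') U) = (\<nu> = \<nu>')"
  proof
    assume eq: "restrict (count \<nu>) U = restrict (count \<nu>') U"
    show "\<nu> = \<nu>'"
    proof (rule multiset_eqI)
      fix C show "count \<nu> C = count \<nu>' C"
        using fun_cong[OF eq, of C] supp by (cases "C \<in> U") (auto, metis not_in_iff subsetD)
    qed
  qed simp
next
  fix \<nu> assume "\<nu> \<in> {\<nu>. \<nu> \<subseteq># \<mu>}"
  then show "restrict (count \<nu>) U \<in> (\<Pi>\<^sub>E C\<in>U. {..count \<mu> C})"
    by (auto simp: subseteq_mset_def)
next
  fix h assume h: "h \<in> (\<Pi>\<^sub>E C\<in>U. {..count \<mu> C})"
  define \<nu> where "\<nu> = (\<Sum>C\<in>U. replicate_mset (h C) C)"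
  have "count \<nu> C = (if C \<in> U then h C else 0)" for C
    using assms(1) by (simp add: \<nu>_def count_sum)
  then show "\<exists>\<nu>\<in>{\<nu>. \<nu> \<subseteq># \<mu>}. h = restrict (count \<nu>) U"
    using h by (intro bexI[of _ \<nu>]) (auto simp: subseteq_mset_def fun_eq_iff restrict_def PiE_def extensional_def Pi_def)
qed

lemma single_power: "Poly_Mapping.single k (a::'a::comm_ring_1) ^ m = Poly_Mapping.single (repeat_mset m k) (a ^ m)"
  by (induction m) (auto simp: mult_single)

lemma prod_single:
  "finite I \<Longrightarrow> (\<Prod>i\<in>I. Poly_Mapping.single (k i :: 'c multiset) (a i::'a::comm_ring_1)) = Poly_Mapping.single (\<Sum>i\<in>I. k i) (\<Prod>i\<in>I. a i)"
  by (induction I rule: finite_induct) (auto simp: mult_single)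

lemma prod_single_power_count:
  assumes "finite U" "set_mset \<nu> \<subseteq> U"
  shows "(\<Prod>C\<in>U. Poly_Mapping.single {#C#} (s::'a::comm_ring_1) ^ count \<nu> C) = Poly_Mapping.single \<nu> (s ^ size \<nu>)"
proof -
  have "(\<Sum>C\<in>U. repeat_mset (count \<nu> C) {#C#}) = \<nu>"
    using assms by (intro multiset_eqI) (auto simp: count_sum not_in_iff subset_iff if_distrib cong: if_cong)
  moreover have "size \<nu> = (\<Sum>C\<in>U. count \<nu> C)"
    unfolding size_multiset_overloaded_eq using assms by (intro sum.mono_neutral_left) (auto simp: not_in_iff)
  ultimately show ?thesis
    using assms(1) by (simp add: single_power prod_single power_sum)
qed

text \<open>For \<open>L = block_form U t\<close>, the choice \<open>s = t\<close> gives the numbers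
  \<open>N_\<mu>\<close> that count permutations, and \<open>s = 1\<close> the companion numbers of
  the second expansion.\<close>

definition block_coeff :: "'c set \<Rightarrow> ('c \<Rightarrow> 'c multiset \<Rightarrow>\<^sub>0 'a) \<Rightarrow> 'a \<Rightarrow> 'c multiset \<Rightarrow> 'a::comm_ring_1" where
  "block_coeff U L s \<mu> =
     Poly_Mapping.lookup (\<Prod>C\<in>U. block_factor (L C) (Poly_Mapping.single {#C#} s) (count \<mu> C)) \<mu>"

text \<open>The parameter \<open>s\<close> occurs only on the right, so two choices of
  \<open>s\<close> give two expansions of one coefficient.\<close>

lemma sum_block_coeff:
  assumes "finite U" "set_mset \<mu> \<subseteq> U"
  shows "Poly_Mapping.lookup (\<Prod>C\<in>U. L C ^ count \<mu> C) \<mu> = (\<Sum>\<nu> | \<nu> \<subseteq># \<mu>. s ^ size \<nu> * block_coeff U L s (\<mu> - \<nu>))"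
proof -
  let ?F = "\<lambda>C k. Poly_Mapping.single {#C#} s ^ k * block_factor (L C) (Poly_Mapping.single {#C#} s) (count \<mu> C - k)"
  have "(\<Prod>C\<in>U. L C ^ count \<mu> C) = (\<Prod>C\<in>U. \<Sum>k\<le>count \<mu> C. ?F C k)"
    by (intro prod.cong refl power_eq_sum_block_factor)
  also have "\<dots> = (\<Sum>h\<in>(\<Pi>\<^sub>E C\<in>U. {..count \<mu> C}). \<Prod>C\<in>U. ?F C (h C))"
    using assms(1) by (intro prod_sum_PiE) auto
  also have "\<dots> = (\<Sum>\<nu> | \<nu> \<subseteq># \<mu>. \<Prod>C\<in>U. ?F C (restrict (count \<nu>) U C))"
    by (rule sum.reindex_bij_betw[OF bij_betw_restrict_count[OF assms], symmetric])
  also have "\<dots> = (\<Sum>\<nu> | \<nu> \<subseteq># \<mu>. Poly_Mapping.single \<nu> (s ^ size \<nu>) *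
     (\<Prod>C\<in>U. block_factor (L C) (Poly_Mapping.single {#C#} s) (count (\<mu> - \<nu>) C)))"
  proof (intro sum.cong refl)
    fix \<nu> assume "\<nu> \<in> {\<nu>. \<nu> \<subseteq># \<mu>}"
    then have "set_mset \<nu> \<subseteq> U" using assms(2) by (auto dest: mset_subset_eqD)
    then show "(\<Prod>C\<in>U. ?F C (restrict (count \<nu>) U C)) = Poly_Mapping.single \<nu> (s ^ size \<nu>) *
     (\<Prod>C\<in>U. block_factor (L C) (Poly_Mapping.single {#C#} s) (count (\<mu> - \<nu>) C))"
      using assms(1) by (simp add: prod.distrib prod_single_power_count)
  qed
  finally show ?thesis
    by (simp add: lookup_sum lookup_single_mult block_coeff_def)
qed

text \<open>With \<open>y\<^sub>C = a + t \<Sum>\<^sub>B\<^sub>\<le>\<^sub>C x\<^sub>B + \<Sum>\<^sub>B\<^sub>>\<^sub>C x\<^sub>B\<close> the second product is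
  the first one shifted by one index, so the two share all factors but the outermost ones.  The common
  cofactor \<open>Q\<close> is kept because the ring need not be an integral domain.\<close>

lemma telescoping_products:
  fixes x :: "'c::linorder \<Rightarrow> 'a::comm_ring_1"
  assumes "finite U" "U \<noteq> {}"
  shows "\<exists>Q. (\<Prod>C\<in>U. a + t * (\<Sum>B | B \<in> U \<and> B \<le> C. x B) + (\<Sum>B | B \<in> U \<and> C < B. x B)) = (a + t * sum x U) * Q
           \<and> (\<Prod>C\<in>U. a + t * (\<Sum>B | B \<in> U \<and> B < C. x B) + (\<Sum>B | B \<in> U \<and> C \<le> B. x B)) = (a + sum x U) * Q"
  using assms
proof (induction U arbitrary: a rule: finite_linorder_max_induct)
  case empty
  then show ?case by simp
next
  case (insert c U)
  have c: "c \<notin> U" using insert by auto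
  have sets: "{B. B \<in> insert c U \<and> B \<le> c} = insert c U" "{B. B \<in> insert c U \<and> c < B} = {}"
    "{B. B \<in> insert c U \<and> B < c} = U" "{B. B \<in> insert c U \<and> c \<le> B} = {c}"
    using insert by force+
  have sets': "{B. B \<in> insert c U \<and> B \<le> C} = {B. B \<in> U \<and> B \<le> C}" "{B. B \<in> insert c U \<and> C < B} = insert c {B. B \<in> U \<and> C < B}"
    "{B. B \<in> insert c U \<and> B < C} = {B. B \<in> U \<and> B < C}" "{B. B \<in> insert c U \<and> C \<le> B} = insert c {B. B \<in> U \<and> C \<le> B}" if "C \<in> U" for C
    using insert that by force+
  \<comment> \<open>Every \<open>C\<close> in \<open>U\<close> lies below the new maximum
    \<open>c\<close>, so \<open>x c\<close> always falls into the upper sum and merges with the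
    constant term. This is why the induction is over arbitrary \<open>a\<close>.\<close>
  have y: "(\<Prod>C\<in>insert c U. a + t * (\<Sum>B | B \<in> insert c U \<and> B \<le> C. x B) + (\<Sum>B | B \<in> insert c U \<and> C < B. x B))
     = (a + t * sum x (insert c U)) * (\<Prod>C\<in>U. (a + x c) + t * (\<Sum>B | B \<in> U \<and> B \<le> C. x B) + (\<Sum>B | B \<in> U \<and> C < B. x B))"
    unfolding prod.insert[OF insert(1) c] sets using insert(1) c
    by (intro arg_cong2[where f="(*)"] prod.cong refl) (simp_all add: sets' add_ac del: insert_iff)
  have z: "(\<Prod>C\<in>insert c U. a + t * (\<Sum>B | B \<in> insert c U \<and> B < C. x B) + (\<Sum>B | B \<in> insert c U \<and> C \<le> B. x B))
     = (a + t * sum x U + x c) * (\<Prod>C\<in>U. (a + x c) + t * (\<Sum>B | B \<in> U \<and> B < C. x B) + (\<Sum>B | B \<in> U \<and> C \<le> B. x B))"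
    unfolding prod.insert[OF insert(1) c] sets using insert(1) c
    by (intro arg_cong2[where f="(*)"] prod.cong refl) (simp_all add: sets' add_ac del: insert_iff)
  show ?case
  proof (cases "U = {}")
    case True
    then show ?thesis unfolding y z by (intro exI[of _ 1]) simp
  next
    case False
    from insert(3)[OF this, of "a + x c"] obtain Q where Q:
      "(\<Prod>C\<in>U. (a + x c) + t * (\<Sum>B | B \<in> U \<and> B \<le> C. x B) + (\<Sum>B | B \<in> U \<and> C < B. x B)) = (a + x c + t * sum x U) * Q"
      "(\<Prod>C\<in>U. (a + x c) + t * (\<Sum>B | B \<in> U \<and> B < C. x B) + (\<Sum>B | B \<in> U \<and> C \<le> B. x B)) = (a + x c + sum x U) * Q"
      by blast
    \<comment> \<open>The outer factor of the second product equals the factor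
      \<open>a + x c + t * sum x U\<close> left over in the first, so it joins the common
      cofactor.\<close>
    show ?thesis unfolding y z Q using insert(1) c
      by (intro exI[of _ "(a + t * sum x U + x c) * Q"]) (simp add: algebra_simps)
  qed
qed

text \<open>The form \<open>L\<^sub>C\<close> lists the blocks from which a value lying in block \<open>C\<close> may come: an excedance
  (weight \<open>t\<close>) comes from a block \<open>B \<le> C\<close>, a non-excedance from a block \<open>B \<ge> C\<close>.\<close>

definition block_form :: "nat set \<Rightarrow> 'a::comm_ring_1 \<Rightarrow> nat \<Rightarrow> nat multiset \<Rightarrow>\<^sub>0 'a" where
  "block_form U t C = (\<Sum>B\<in>{B \<in> U. B \<le> C}. Poly_Mapping.single {#B#} t) + (\<Sum>B\<in>{B \<in> U. C \<le> B}. Poly_Mapping.single {#B#} 1)"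

text \<open>The form \<open>L_C\<close> contains \<open>x_C\<close> with coefficient 1 + t.
  Subtracting \<open>x_C\<close> leaves weight t on B \<le> C and 1 on B > C; subtracting
  \<open>t * x_C\<close> leaves t on B < C and 1 on B \<ge> C. These are the two telescoping
  products for \<open>a = 0\<close>, with outer factors \<open>T * sum x U\<close> and
  \<open>sum x U\<close>.\<close>

lemma prod_block_form_diff:
  assumes "finite U" "U \<noteq> {}"
  shows "(\<Prod>C\<in>U. block_form U t C - Poly_Mapping.single {#C#} 1) =
    Poly_Mapping.single {#} t * (\<Prod>C\<in>U. block_form U t C - Poly_Mapping.single {#C#} t)"
proof -
  define T where "T = Poly_Mapping.single ({#}::nat multiset) t"
  define x where "x = (\<lambda>B::nat. Poly_Mapping.single {#B#} (1::'a))"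
  have Tx: "T * x B = Poly_Mapping.single {#B#} t" for B
    by (simp add: T_def x_def mult_single)
  have form: "block_form U t C = T * (\<Sum>B | B \<in> U \<and> B \<le> C. x B) + (\<Sum>B | B \<in> U \<and> C \<le> B. x B)" for C
    by (simp add: block_form_def sum_distrib_left Tx) (simp add: x_def)
  have le: "{B. B \<in> U \<and> B \<le> C} = insert C {B. B \<in> U \<and> B < C}" "{B. B \<in> U \<and> C \<le> B} = insert C {B. B \<in> U \<and> C < B}" if "C \<in> U" for C
    using that by auto
  have 1: "block_form U t C - x C = 0 + T * (\<Sum>B | B \<in> U \<and> B \<le> C. x B) + (\<Sum>B | B \<in> U \<and> C < B. x B)" if "C \<in> U" for C
    using assms(1) that unfolding form le(2)[OF that] by simp
  have 2: "block_form U t C - T * x C = 0 + T * (\<Sum>B | B \<in> U \<and> B < C. x B) + (\<Sum>B | B \<in> U \<and> C \<le> B. x B)" if "C \<in> U" for C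
    using assms(1) that unfolding form le(1)[OF that] by (simp add: distrib_left)
  obtain Q where "(\<Prod>C\<in>U. 0 + T * (\<Sum>B | B \<in> U \<and> B \<le> C. x B) + (\<Sum>B | B \<in> U \<and> C < B. x B)) = (0 + T * sum x U) * Q"
      "(\<Prod>C\<in>U. 0 + T * (\<Sum>B | B \<in> U \<and> B < C. x B) + (\<Sum>B | B \<in> U \<and> C \<le> B. x B)) = (0 + sum x U) * Q"
    using telescoping_products[OF assms, of 0 T x] by blast
  then have "(\<Prod>C\<in>U. block_form U t C - x C) = T * (\<Prod>C\<in>U. block_form U t C - T * x C)"
    using 1 2 by (simp add: mult.assoc)
  then show ?thesis unfolding Tx by (simp add: T_def x_def)
qed

text \<open>When the variables are exactly the support of \<open>\<mu>\<close>, every count is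
  positive, so each block contributes one factor \<open>L_C - y_C\<close> and the product identity
  for nonempty \<open>U\<close> applies to the whole product.\<close>

lemma block_coeff_one:
  assumes "\<mu> \<noteq> {#}"
  shows "block_coeff (set_mset \<mu>) (block_form (set_mset \<mu>) t) 1 \<mu> = t * block_coeff (set_mset \<mu>) (block_form (set_mset \<mu>) t) t \<mu>"
proof -
  have "(\<Prod>C\<in>set_mset \<mu>. block_factor (L C) (y C) (count \<mu> C)) = (\<Prod>C\<in>set_mset \<mu>. L C - y C) * (\<Prod>C\<in>set_mset \<mu>. L C ^ (count \<mu> C - 1))"
    for L y :: "nat \<Rightarrow> nat multiset \<Rightarrow>\<^sub>0 'a"
    by (subst prod.distrib[symmetric], intro prod.cong) (auto simp: block_factor_def count_eq_zero_iff)
  moreover have "set_mset \<mu> \<noteq> {}" using assms by simp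
  ultimately show ?thesis
    by (simp add: block_coeff_def prod_block_form_diff mult.assoc lookup_single_mult)
qed

text \<open>The forms over \<open>U\<close> and \<open>V\<close> agree modulo the variables outside
  \<open>V\<close>, and blocks outside the support of \<open>\<mu>\<close> contribute the factor
  1.\<close>

lemma block_coeff_support:
  assumes "finite U" "set_mset \<mu> \<subseteq> V" "V \<subseteq> U"
  shows "block_coeff U (block_form U t) s \<mu> = block_coeff V (block_form V t) s \<mu>"
proof -
  have form: "agree_on V (block_form U t C) (block_form V t C)" for C
    unfolding block_form_def by (intro agree_on_add agree_on_linear assms)
  have "(\<Prod>C\<in>U. block_factor (block_form U t C) (Poly_Mapping.single {#C#} s) (count \<mu> C)) =
     (\<Prod>C\<in>V. block_factor (block_form U t C) (Poly_Mapping.single {#C#} s) (count \<mu> C))"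
    using assms by (intro prod.mono_neutral_right) (auto simp: block_factor_def)
  moreover have "agree_on V (\<Prod>C\<in>V. block_factor (block_form U t C) (Poly_Mapping.single {#C#} s) (count \<mu> C))
     (\<Prod>C\<in>V. block_factor (block_form V t C) (Poly_Mapping.single {#C#} s) (count \<mu> C))"
    by (intro agree_on_prod) (auto simp: block_factor_def count_eq_zero_iff intro!: agree_on_mult agree_on_diff agree_on_power form)
  ultimately show ?thesis
    using assms by (simp add: block_coeff_def agree_on_def)
qed

section \<open>The recurrence for the excedance coefficients\<close>

definition exc_coeff :: "'a::comm_ring_1 \<Rightarrow> nat multiset \<Rightarrow> 'a" where
  "exc_coeff t \<mu> = block_coeff (set_mset \<mu>) (block_form (set_mset \<mu>) t) t \<mu>"

lemma finite_submultisets [simp]: "finite {\<nu>. \<nu> \<subseteq># (\<mu>::'c multiset)}"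
  using bij_betw_finite[OF bij_betw_restrict_count[of "set_mset \<mu>" \<mu>]] by (simp add: finite_PiE)

text \<open>Both sides are the coefficient \<open>M_\<mu>\<close>, expanded with
  \<open>s = t\<close> and with \<open>s = 1\<close>. The term \<open>\<nu> = \<mu>\<close> leaves
  the empty multiset, where both block coefficients are 1 instead of differing by the factor t; this
  produces \<open>1 - t\<close>.\<close>

lemma exc_coeff_rec:
  "(\<Sum>\<nu> | \<nu> \<subseteq># \<mu>. t ^ size \<nu> * exc_coeff t (\<mu> - \<nu>)) = t * (\<Sum>\<nu> | \<nu> \<subseteq># \<mu>. exc_coeff t (\<mu> - \<nu>)) + (1 - t)"
proof -
  let ?U = "set_mset \<mu>"
  have supp: "set_mset (\<mu> - \<nu>) \<subseteq> ?U" for \<nu>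
    by (meson in_diffD subsetI)
  have t: "block_coeff ?U (block_form ?U t) t (\<mu> - \<nu>) = exc_coeff t (\<mu> - \<nu>)" for \<nu>
    unfolding exc_coeff_def using supp by (intro block_coeff_support) auto
  have 1: "block_coeff ?U (block_form ?U t) 1 (\<mu> - \<nu>) = t * exc_coeff t (\<mu> - \<nu>) + (if \<nu> = \<mu> then 1 - t else 0)"
    if "\<nu> \<subseteq># \<mu>" for \<nu>
  proof (cases "\<nu> = \<mu>")
    case True
    then show ?thesis by (simp add: block_coeff_def exc_coeff_def block_factor_def)
  next
    case False
    then have ne: "\<mu> - \<nu> \<noteq> {#}" using that by (metis subset_mset.diff_add add_0)
    have "block_coeff ?U (block_form ?U t) 1 (\<mu> - \<nu>) = block_coeff (set_mset (\<mu> - \<nu>)) (block_form (set_mset (\<mu> - \<nu>)) t) 1 (\<mu> - \<nu>)"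
      using supp by (intro block_coeff_support) auto
    then show ?thesis using ne False by (simp add: block_coeff_one exc_coeff_def)
  qed
  have "(\<Sum>\<nu> | \<nu> \<subseteq># \<mu>. t ^ size \<nu> * exc_coeff t (\<mu> - \<nu>)) = (\<Sum>\<nu> | \<nu> \<subseteq># \<mu>. t ^ size \<nu> * block_coeff ?U (block_form ?U t) t (\<mu> - \<nu>))"
    by (simp add: t)
  also have "\<dots> = (\<Sum>\<nu> | \<nu> \<subseteq># \<mu>. 1 ^ size \<nu> * block_coeff ?U (block_form ?U t) 1 (\<mu> - \<nu>))"
    by (subst (1 2) sum_block_coeff[symmetric]) auto
  also have "\<dots> = (\<Sum>\<nu> | \<nu> \<subseteq># \<mu>. t * exc_coeff t (\<mu> - \<nu>) + (if \<nu> = \<mu> then 1 - t else 0))"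
    by (intro sum.cong refl) (simp add: 1)
  also have "\<dots> = t * (\<Sum>\<nu> | \<nu> \<subseteq># \<mu>. exc_coeff t (\<mu> - \<nu>)) + (1 - t)"
    by (simp add: sum.distrib sum_distrib_left sum.delta)
  finally show ?thesis .
qed

section \<open>Words that increase on blocks\<close>

text \<open>Generating function of the admissible values of the marking at a letter with
  \<open>k\<close> occurrences. It is an empty sum for k \<le> 1, which excludes letters occurring
  fewer than two times.\<close>

definition mark_weight :: "'a::comm_ring_1 \<Rightarrow> nat \<Rightarrow> 'a" where
  "mark_weight t k = (\<Sum>i\<in>{1..k - 1}. t ^ i)"

lemma mark_weight_le_1: "k \<le> 1 \<Longrightarrow> mark_weight t k = 0"
  by (simp add: mark_weight_def)

lemma mark_weight_mult:
  assumes "1 \<le> k"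
  shows "(1 - t) * mark_weight t k = t - t ^ k"
  using assms
proof (induction k rule: dec_induct)
  case base
  then show ?case by (simp add: mark_weight_def)
next
  case (step k)
  have "mark_weight t (Suc k) = mark_weight t k + t ^ k"
    using step by (cases k) (auto simp: mark_weight_def)
  then show ?case using step.IH by (simp only: distrib_left) (simp add: algebra_simps)
qed

text \<open>Here \<open>\<nu>\<close> records the blocks of the positions that carry the current
  largest letter. The base value 1 stands for filling all remaining positions with the letter
  0.\<close>

fun layer_sum :: "'a::comm_ring_1 \<Rightarrow> nat \<Rightarrow> 'c multiset \<Rightarrow> 'a" where
  "layer_sum t 0 \<mu> = 1"
| "layer_sum t (Suc m) \<mu> = (\<Sum>\<nu> | \<nu> \<subseteq># \<mu>. mark_weight t (size \<nu>) * layer_sum t m (\<mu> - \<nu>))"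

text \<open>A letter of nonzero weight takes at least two positions, so there cannot be more letters
  than positions. Hence cutting off the sum in \<open>code_coeff\<close> at
  \<open>size \<mu>\<close> loses nothing.\<close>

lemma layer_sum_eq_0: "size \<mu> < m \<Longrightarrow> layer_sum t m \<mu> = 0"
proof (induction m arbitrary: \<mu>)
  case 0
  then show ?case by simp
next
  case (Suc m)
  have "mark_weight t (size \<nu>) * layer_sum t m (\<mu> - \<nu>) = 0" if "\<nu> \<subseteq># \<mu>" for \<nu>
  proof (cases "size \<nu> \<le> 1")
    case True
    then show ?thesis by (simp add: mark_weight_le_1)
  next
    case False
    with Suc.prems size_mset_mono[OF that] have "size (\<mu> - \<nu>) < m"
      using that by (simp add: size_Diff_submset)
    with Suc.IH show ?thesis by simp
  qed
  then show ?case by simp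
qed

definition code_coeff :: "'a::comm_ring_1 \<Rightarrow> 'c multiset \<Rightarrow> 'a" where
  "code_coeff t \<mu> = (\<Sum>m\<le>size \<mu>. layer_sum t m \<mu>)"

lemma code_coeff_eq: "size \<mu> \<le> M \<Longrightarrow> code_coeff t \<mu> = (\<Sum>m\<le>M. layer_sum t m \<mu>)"
  unfolding code_coeff_def by (intro sum.mono_neutral_left) (auto simp: layer_sum_eq_0)

text \<open>The all-zero word accounts for the 1; in every other case the largest letter is split
  off.\<close>

lemma code_coeff_rec:
  "code_coeff t \<mu> = 1 + (\<Sum>\<nu> | \<nu> \<subseteq># \<mu>. mark_weight t (size \<nu>) * code_coeff t (\<mu> - \<nu>))"
proof -
  have "code_coeff t \<mu> = (\<Sum>m\<le>Suc (size \<mu>). layer_sum t m \<mu>)"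
    by (intro code_coeff_eq) simp
  also have "\<dots> = 1 + (\<Sum>m\<le>size \<mu>. \<Sum>\<nu> | \<nu> \<subseteq># \<mu>. mark_weight t (size \<nu>) * layer_sum t m (\<mu> - \<nu>))"
    by (subst sum.atMost_Suc_shift) simp
  also have "(\<Sum>m\<le>size \<mu>. \<Sum>\<nu> | \<nu> \<subseteq># \<mu>. mark_weight t (size \<nu>) * layer_sum t m (\<mu> - \<nu>)) =
     (\<Sum>\<nu> | \<nu> \<subseteq># \<mu>. mark_weight t (size \<nu>) * code_coeff t (\<mu> - \<nu>))"
    by (subst sum.swap, intro sum.cong refl)
      (simp add: sum_distrib_left[symmetric] code_coeff_eq[of _ "size \<mu>"] size_Diff_submset)
  finally show ?thesis .
qed

text \<open>Isolating the empty \<open>\<nu>\<close> in \<open>exc_coeff_rec\<close> puts the factor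
  \<open>1 - t\<close> on the left and \<open>t - t ^ size \<nu>\<close> on the right, which is
  \<open>(1 - t) * mark_weight t (size \<nu>)\<close>. Cancelling \<open>1 - t\<close> leaves the
  recurrence of \<open>code_coeff\<close>.\<close>

lemma exc_coeff_eq_code_coeff:
  fixes t :: "'a::idom"
  assumes "t \<noteq> 1"
  shows "exc_coeff t \<mu> = code_coeff t \<mu>"
proof (induction "size \<mu>" arbitrary: \<mu> rule: less_induct)
  case less
  let ?I = "{\<nu>. \<nu> \<subseteq># \<mu>} - {{#}}"
  have split: "(\<Sum>\<nu> | \<nu> \<subseteq># \<mu>. F \<nu>) = F {#} + sum F ?I" for F :: "nat multiset \<Rightarrow> 'a"
    by (subst sum.remove[of _ "{#}"]) auto
  have IH: "exc_coeff t (\<mu> - \<nu>) = code_coeff t (\<mu> - \<nu>)" if "\<nu> \<in> ?I" for \<nu>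
  proof -
    have "size \<nu> \<le> size \<mu>" "0 < size \<nu>" using that by (auto intro: size_mset_mono simp: nonempty_has_size)
    then show ?thesis using that by (intro less) (auto simp: size_Diff_submset simp del: size_eq_0_iff_empty)
  qed
  have "(1 - t) * exc_coeff t \<mu> = (1 - t) + (\<Sum>\<nu>\<in>?I. (t - t ^ size \<nu>) * exc_coeff t (\<mu> - \<nu>))"
    using exc_coeff_rec[of t \<mu>] by (simp add: split algebra_simps sum_distrib_left sum_subtractf)
  also have "\<dots> = (1 - t) + (\<Sum>\<nu>\<in>?I. (1 - t) * (mark_weight t (size \<nu>) * code_coeff t (\<mu> - \<nu>)))"
  proof (intro arg_cong2[where f="(+)"] sum.cong refl)
    fix \<nu> assume I: "\<nu> \<in> ?I"
    then have "1 \<le> size \<nu>" by (metis Diff_iff One_nat_def Suc_leI insertI1 nonempty_has_size)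
    then show "(t - t ^ size \<nu>) * exc_coeff t (\<mu> - \<nu>) = (1 - t) * (mark_weight t (size \<nu>) * code_coeff t (\<mu> - \<nu>))"
      by (simp add: mult.assoc[symmetric] mark_weight_mult IH[OF I])
  qed
  also have "\<dots> = (1 - t) * code_coeff t \<mu>"
    by (subst (2) code_coeff_rec) (simp add: split sum_distrib_left distrib_left mark_weight_le_1)
  finally show ?case using assms by simp
qed

section \<open>Words on blocks, built up by their largest letter\<close>

lemma card_top_elements:
  fixes A :: "'c::linorder set"
  assumes "finite A" "k \<le> card A"
  shows "card {v \<in> A. card {u \<in> A. v < u} < k} = k"
proof -
  let ?g = "\<lambda>v. card {u \<in> A. v < u}"
  have inj: "inj_on ?g A"
  proof (rule linorder_inj_onI')
    fix p q assume "p \<in> A" "q \<in> A" "p < q"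
    then have "{u \<in> A. q < u} \<subset> {u \<in> A. p < u}" by auto
    then have "?g q < ?g p" using assms by (intro psubset_card_mono) auto
    then show "?g p \<noteq> ?g q" by simp
  qed
  have lt: "?g p < card A" if "p \<in> A" for p
    using assms that by (intro psubset_card_mono) auto
  have img: "?g ` A = {..<card A}"
    using inj lt by (intro card_subset_eq) (auto simp: card_image)
  have "?g ` {v \<in> A. ?g v < k} = {..<k}"
    using img assms(2) by (auto simp: set_eq_iff image_iff) (metis lessThan_iff imageE order_less_le_trans)
  moreover have "inj_on ?g {v \<in> A. ?g v < k}" using inj by (rule inj_on_subset) auto
  ultimately show ?thesis using card_image[of ?g "{v \<in> A. ?g v < k}"] by simp
qed

text \<open>The possible position sets of the largest letter in a word that weakly increases on each
  block.\<close>

definition block_upper_sets :: "('c::linorder \<Rightarrow> 'b) \<Rightarrow> 'c set \<Rightarrow> 'c set set" where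
  "block_upper_sets b A = {P. P \<subseteq> A \<and> (\<forall>u\<in>P. \<forall>v\<in>A. u < v \<and> b u = b v \<longrightarrow> v \<in> P)}"

text \<open>Inside one block an upper set is determined by its size, and every size up to that of
  the block occurs.\<close>

lemma bij_betw_block_upper_sets:
  assumes "finite A"
  shows "bij_betw (\<lambda>P. image_mset b (mset_set P)) (block_upper_sets b A) {\<nu>. \<nu> \<subseteq># image_mset b (mset_set A)}"
proof (rule bij_betwI')
  fix P Q assume PQ: "P \<in> block_upper_sets b A" "Q \<in> block_upper_sets b A"
  then have fin: "finite P" "finite Q" using assms by (auto simp: block_upper_sets_def intro: finite_subset)
  show "(image_mset b (mset_set P) = image_mset b (mset_set Q)) = (P = Q)"
  proof
    assume eq: "image_mset b (mset_set P) = image_mset b (mset_set Q)"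
    have "{v \<in> P. b v = C} = {v \<in> Q. b v = C}" for C
    proof -
      have c: "card {v \<in> P. b v = C} = card {v \<in> Q. b v = C}"
        using arg_cong[OF eq, of "\<lambda>M. count M C"] fin by (simp add: count_image_mset_eq_card_vimage)
      have "{v \<in> P. b v = C} \<subseteq> {v \<in> Q. b v = C} \<or> {v \<in> Q. b v = C} \<subseteq> {v \<in> P. b v = C}"
      proof (rule ccontr)
        assume "\<not> ?thesis"
        then obtain p q where "p \<in> P" "b p = C" "p \<notin> Q" "q \<in> Q" "b q = C" "q \<notin> P" by blast
        with PQ show False by (cases p q rule: linorder_cases) (auto simp: block_upper_sets_def)
      qed
      moreover have "finite {v \<in> P. b v = C}" "finite {v \<in> Q. b v = C}" using fin by simp_all
      ultimately show ?thesis using c card_subset_eq[of "{v \<in> Q. b v = C}" "{v \<in> P. b v = C}"]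
          card_subset_eq[of "{v \<in> P. b v = C}" "{v \<in> Q. b v = C}"] by auto
    qed
    then show "P = Q" by blast
  qed simp
next
  fix P assume "P \<in> block_upper_sets b A"
  then show "image_mset b (mset_set P) \<in> {\<nu>. \<nu> \<subseteq># image_mset b (mset_set A)}"
    using assms by (auto simp: block_upper_sets_def intro!: image_mset_subseteq_mono subset_imp_msubset_mset_set)
next
  fix \<nu> assume \<nu>: "\<nu> \<in> {\<nu>. \<nu> \<subseteq># image_mset b (mset_set A)}"
  \<comment> \<open>From each block \<open>C\<close> take its \<open>count \<nu> C\<close> largest
    elements.\<close>
  define P where "P = {v \<in> A. card {u \<in> A. b u = b v \<and> v < u} < count \<nu> (b v)}"
  have P: "P \<in> block_upper_sets b A"
  proof -
    have "card {u \<in> A. b u = b v \<and> v < u} \<le> card {u \<in> A. b u = b w \<and> w < u}" if "w < v" "b w = b v" for v w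
      using that assms by (intro card_mono) auto
    then show ?thesis unfolding block_upper_sets_def P_def by (fastforce intro: order_le_less_trans)
  qed
  have "image_mset b (mset_set P) = \<nu>"
  proof (rule multiset_eqI)
    fix C
    have le: "count \<nu> C \<le> card {v \<in> A. b v = C}"
      using \<nu> assms by (auto simp: subseteq_mset_def count_image_mset_eq_card_vimage dest: spec[of _ C])
    have "{v \<in> P. b v = C} = {v \<in> {v \<in> A. b v = C}. card {u \<in> {v \<in> A. b v = C}. v < u} < count \<nu> C}"
      by (auto simp: P_def conj_ac)
    then have "card {v \<in> P. b v = C} = count \<nu> C"
      using card_top_elements[OF _ le] assms by simp
    moreover have "finite P" using assms by (simp add: P_def)
    ultimately show "count (image_mset b (mset_set P)) C = count \<nu> C"
      by (simp add: count_image_mset_eq_card_vimage)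
  qed
  with P show "\<exists>P\<in>block_upper_sets b A. \<nu> = image_mset b (mset_set P)" by blast
qed

definition block_words :: "('c::linorder \<Rightarrow> 'b) \<Rightarrow> 'c set \<Rightarrow> nat \<Rightarrow> ('c \<Rightarrow> nat) set" where
  "block_words b A m = {\<alpha> \<in> A \<rightarrow>\<^sub>E {0..m}. \<forall>u\<in>A. \<forall>v\<in>A. u < v \<and> b u = b v \<longrightarrow> \<alpha> u \<le> \<alpha> v}"

lemma finite_block_words: "finite A \<Longrightarrow> finite (block_words b A m)"
  by (simp add: block_words_def finite_PiE)

text \<open>The positions of the letter \<open>Suc m\<close> form an upper set \<open>P\<close>, and
  the rest is an arbitrary block word on \<open>A - P\<close>. Replacing \<open>P\<close> by its
  multiset of blocks gives the recursion of \<open>layer_sum\<close>.\<close>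

lemma sum_block_words:
  assumes "finite A"
  shows "(\<Sum>\<alpha>\<in>block_words b A m. \<Prod>k\<in>{1..m}. mark_weight t (card {v \<in> A. \<alpha> v = k})) =
         layer_sum t m (image_mset b (mset_set A))"
  using assms
proof (induction m arbitrary: A)
  case 0
  have "block_words b A 0 = {\<lambda>v\<in>A. 0}"
    by (auto simp: block_words_def PiE_def extensional_def fun_eq_iff)
  then show ?case by simp
next
  case (Suc m)
  let ?U = "block_upper_sets b A"
  have fU: "finite ?U"
    using Suc.prems by (auto simp: block_upper_sets_def intro: finite_subset[of _ "Pow A"])
  have fin: "finite (A - P)" for P using Suc.prems by simp
  let ?W = "\<lambda>m A \<alpha>. \<Prod>k\<in>{1..m}. mark_weight t (card {v \<in> A. \<alpha> v = k})"
  have "(\<Sum>\<alpha>\<in>block_words b A (Suc m). ?W (Suc m) A \<alpha>) =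
     (\<Sum>(P, \<beta>)\<in>Sigma ?U (\<lambda>P. block_words b (A - P) m). mark_weight t (card P) * ?W m (A - P) \<beta>)"
  proof (rule sum.reindex_bij_witness[where
        j = "\<lambda>\<alpha>. ({v \<in> A. \<alpha> v = Suc m}, restrict \<alpha> {v \<in> A. \<alpha> v \<noteq> Suc m})" and
        i = "\<lambda>(P, \<beta>). \<lambda>v. if v \<in> P then Suc m else if v \<in> A then \<beta> v else undefined"], goal_cases)
    case (1 \<alpha>)
    then show ?case by (auto simp: block_words_def PiE_def extensional_def fun_eq_iff)
  next
    case (2 \<alpha>)
    have D: "A - {v \<in> A. \<alpha> v = Suc m} = {v \<in> A. \<alpha> v \<noteq> Suc m}" by auto
    have le: "\<alpha> v \<le> Suc m" if "v \<in> A" for v using 2 that by (auto simp: block_words_def)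
    have "\<alpha> v \<le> m" if "v \<in> A" "\<alpha> v \<noteq> Suc m" for v using le[OF that(1)] that by simp
    moreover have "\<alpha> v = Suc m" if "u \<in> A" "v \<in> A" "u < v" "b u = b v" "\<alpha> u = Suc m" for u v
      using 2 that le[of v] by (auto simp: block_words_def intro!: antisym)
    ultimately show ?case using 2 by (auto simp: D block_words_def block_upper_sets_def)
  next
    case (3 p)
    then obtain P \<beta> where p: "p = (P, \<beta>)" "P \<subseteq> A" "\<beta> \<in> (A - P) \<rightarrow>\<^sub>E {0..m}"
      by (auto simp: block_words_def block_upper_sets_def)
    have \<beta>: "\<beta> v \<noteq> Suc m" if "v \<in> A" "v \<notin> P" for v using PiE_mem[OF p(3), of v] that by simp
    let ?\<gamma> = "\<lambda>v. if v \<in> P then Suc m else if v \<in> A then \<beta> v else undefined"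
    have 1: "{v \<in> A. ?\<gamma> v = Suc m} = P" using p(2) \<beta> by auto
    have 2: "{v \<in> A. ?\<gamma> v \<noteq> Suc m} = A - P" using p(2) \<beta> by auto
    have "restrict ?\<gamma> (A - P) = \<beta>"
    proof
      fix v show "restrict ?\<gamma> (A - P) v = \<beta> v"
        using PiE_arb[OF p(3), of v] by (cases "v \<in> A - P") auto
    qed
    then show ?case unfolding p(1) prod.case 1 2 by simp
  next
    case (4 p)
    then obtain P \<beta> where p: "p = (P, \<beta>)" "P \<in> ?U" "\<beta> \<in> block_words b (A - P) m" by auto
    then have P: "P \<subseteq> A" "\<And>u v. u \<in> P \<Longrightarrow> v \<in> A \<Longrightarrow> u < v \<Longrightarrow> b u = b v \<Longrightarrow> v \<in> P"
      by (auto simp: block_upper_sets_def)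
    have \<beta>: "\<beta> v \<le> m" if "v \<in> A" "v \<notin> P" for v
      using p(3) that by (auto simp: block_words_def)
    have mono: "\<beta> u \<le> \<beta> v" if "u \<in> A" "u \<notin> P" "v \<in> A" "v \<notin> P" "u < v" "b u = b v" for u v
      using p(3) that by (auto simp: block_words_def)
    show ?case unfolding p(1) prod.case block_words_def
      using P \<beta> mono by (auto simp: le_SucI)
  next
    case (5 \<alpha>)
    have D: "A - {v \<in> A. \<alpha> v = Suc m} = {v \<in> A. \<alpha> v \<noteq> Suc m}" by auto
    have "?W m {v \<in> A. \<alpha> v \<noteq> Suc m} (restrict \<alpha> {v \<in> A. \<alpha> v \<noteq> Suc m}) = ?W m A \<alpha>"
      by (intro prod.cong refl arg_cong[where f="\<lambda>S. mark_weight t (card S)"]) auto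
    then show ?case unfolding D prod.case by (simp add: prod.nat_ivl_Suc' mult.commute)
  qed
  also have "\<dots> = (\<Sum>P\<in>?U. \<Sum>\<beta>\<in>block_words b (A - P) m. mark_weight t (card P) * ?W m (A - P) \<beta>)"
    using fU fin by (subst sum.Sigma) (auto simp: finite_block_words)
  also have "\<dots> = (\<Sum>P\<in>?U. mark_weight t (card P) * layer_sum t m (image_mset b (mset_set (A - P))))"
    by (intro sum.cong refl, subst sum_distrib_left[symmetric], subst Suc.IH[OF fin]) (rule refl)
  also have "\<dots> = (\<Sum>P\<in>?U. mark_weight t (size (image_mset b (mset_set P))) *
      layer_sum t m (image_mset b (mset_set A) - image_mset b (mset_set P)))"
  proof (intro sum.cong refl)
    fix P assume "P \<in> ?U"
    then have "P \<subseteq> A" by (simp add: block_upper_sets_def)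
    then have "image_mset b (mset_set A) = image_mset b (mset_set P) + image_mset b (mset_set (A - P))"
      using Suc.prems mset_set_Union[of P "A - P"]
      by (simp add: finite_subset Un_absorb1 flip: image_mset_union)
    then show "mark_weight t (card P) * layer_sum t m (image_mset b (mset_set (A - P))) =
      mark_weight t (size (image_mset b (mset_set P))) *
      layer_sum t m (image_mset b (mset_set A) - image_mset b (mset_set P))" by simp
  qed
  also have "\<dots> = layer_sum t (Suc m) (image_mset b (mset_set A))"
    using sum.reindex_bij_betw[OF bij_betw_block_upper_sets[OF Suc.prems, of b],
      of "\<lambda>\<nu>. mark_weight t (size \<nu>) * layer_sum t m (image_mset b (mset_set A) - \<nu>)"] by simp
  finally show ?case .
qed

section \<open>Permutations with prescribed barred descents\<close>

text \<open>The descent set of the word in which the excedance values of \<open>\<sigma>\<close> are barred, for the order in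
  which every barred letter precedes every unbarred one.\<close>

definition dex_descents :: "nat \<Rightarrow> (nat \<Rightarrow> nat) \<Rightarrow> nat set" where
  "dex_descents n \<sigma> = {i \<in> {1..<n}. \<sigma> i \<le> i \<and> Suc i < \<sigma> (Suc i) \<or>
     (i < \<sigma> i \<longleftrightarrow> Suc i < \<sigma> (Suc i)) \<and> \<sigma> (Suc i) < \<sigma> i}"

text \<open>Summation by parts.\<close>

lemma sum_mult_diff_Suc:
  fixes e :: "nat \<Rightarrow> int"
  shows "(\<Sum>i\<in>{1..<Suc n}. int i * (e i - e (Suc i))) + int n * e (Suc n) = (\<Sum>i\<in>{1..<Suc n}. e i)"
  by (induction n) (auto simp: algebra_simps)

lemma maj_eq_sum_dex_descents:
  assumes "\<sigma> permutes {1..n}"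
  shows "maj n \<sigma> = \<Sum>(dex_descents n \<sigma>) + exc n \<sigma>"
proof (cases n)
  case 0
  then show ?thesis by (simp add: maj_def dex_descents_def exc_def)
next
  case (Suc m)
  define e where "e i = (of_bool (i < \<sigma> i) :: int)" for i
  let ?M = "{i \<in> {1..<n}. \<sigma> i > \<sigma> (Suc i)}" and ?D = "dex_descents n \<sigma>"
  have le: "\<sigma> n \<le> n" using permutes_in_image[OF assms, of n] Suc by auto
  have en: "e (Suc m) = 0" using le Suc by (simp add: e_def)
  have ne: "\<sigma> (Suc i) \<noteq> \<sigma> i" for i using permutes_inj[OF assms] by (metis injD n_not_Suc_n)
  \<comment> \<open>Barring changes the descent status only if exactly one of \<open>i\<close>,
    \<open>Suc i\<close> is an excedance position. An excedance followed by a non-excedance is a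
    descent that barring removes; in the opposite order barring creates one.\<close>
  have local: "int i * of_bool (i \<in> ?M) = int i * of_bool (i \<in> ?D) + int i * (e i - e (Suc i))" if "i \<in> {1..<n}" for i
    using that ne[of i] by (auto simp: dex_descents_def e_def of_bool_def)
  have sum: "int (\<Sum>S) = (\<Sum>i\<in>{1..<n}. int i * of_bool (i \<in> S))" if "S \<subseteq> {1..<n}" for S
    using that by (simp add: of_nat_sum of_bool_def if_distrib Int_absorb1 sum.inter_restrict[symmetric] cong: if_cong)
  have "int (maj n \<sigma>) = (\<Sum>i\<in>{1..<n}. int i * of_bool (i \<in> ?M))"
    unfolding maj_def by (rule sum) auto
  also have "\<dots> = (\<Sum>i\<in>{1..<n}. int i * of_bool (i \<in> ?D)) + (\<Sum>i\<in>{1..<n}. int i * (e i - e (Suc i)))"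
    by (simp only: sum.distrib[symmetric] local cong: sum.cong)
  also have "(\<Sum>i\<in>{1..<n}. int i * of_bool (i \<in> ?D)) = int (\<Sum>?D)"
    by (rule sum[symmetric]) (auto simp: dex_descents_def)
  also have "(\<Sum>i\<in>{1..<n}. int i * (e i - e (Suc i))) = (\<Sum>i\<in>{1..<n}. e i)"
    using sum_mult_diff_Suc[of e m] en Suc by simp
  also have "\<dots> = (\<Sum>i\<in>{1..n}. e i)"
    using en Suc by (simp add: atLeastLessThanSuc_atLeastAtMost)
  also have "\<dots> = int (exc n \<sigma>)"
    by (simp add: exc_def e_def of_bool_def sum.inter_filter[symmetric])
  finally show ?thesis by linarith
qed

lemma sum_singleton_mset: "finite I \<Longrightarrow> (\<Sum>v\<in>I. {#f v#}) = image_mset f (mset_set I)"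
  by (induction I rule: finite_induct) auto

lemma lookup_prod_sum_single:
  fixes w :: "'y \<Rightarrow> 'a::comm_ring_1"
  assumes "finite I" "\<And>v. v \<in> I \<Longrightarrow> finite (Y v)"
  shows "Poly_Mapping.lookup (\<Prod>v\<in>I. \<Sum>y\<in>Y v. Poly_Mapping.single {#\<beta> y#} (w y)) \<mu> =
    (\<Sum>g | g \<in> PiE I Y \<and> image_mset (\<lambda>v. \<beta> (g v)) (mset_set I) = \<mu>. \<Prod>v\<in>I. w (g v))"
proof -
  have fin: "finite (PiE I Y)" using assms by (intro finite_PiE) auto
  have "(\<Prod>v\<in>I. \<Sum>y\<in>Y v. Poly_Mapping.single {#\<beta> y#} (w y)) =
     (\<Sum>g\<in>PiE I Y. Poly_Mapping.single (image_mset (\<lambda>v. \<beta> (g v)) (mset_set I)) (\<Prod>v\<in>I. w (g v)))"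
    using assms by (simp add: prod_sum_PiE prod_single sum_singleton_mset)
  then show ?thesis
    using fin by (simp add: lookup_sum lookup_single when_def sum.inter_filter[symmetric])
qed

section \<open>Sorting permutations for an injective key\<close>

lemma ex_sorting_permutation:
  fixes key :: "nat \<Rightarrow> nat"
  assumes "inj_on key {1..n}"
  obtains \<sigma> where "\<sigma> permutes {1..n}" "\<And>i j. i \<in> {1..n} \<Longrightarrow> j \<in> {1..n} \<Longrightarrow> i < j \<Longrightarrow> key (\<sigma> i) < key (\<sigma> j)"
proof -
  \<comment> \<open>The rank of \<open>v\<close> by key; the inverse of \<open>\<pi>\<close> lists
    the values by increasing key.\<close>
  define \<pi> where "\<pi> v = (if v \<in> {1..n} then card {u \<in> {1..n}. key u \<le> key v} else v)" for v
  have mono: "\<pi> u < \<pi> v" if "u \<in> {1..n}" "v \<in> {1..n}" "key u < key v" for u v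
  proof -
    have "{x \<in> {1..n}. key x \<le> key u} \<subset> {x \<in> {1..n}. key x \<le> key v}"
      using that by (auto simp: set_eq_iff psubset_eq not_le intro!: exI[of _ v])
    then show ?thesis using that by (simp add: \<pi>_def psubset_card_mono)
  qed
  have inj: "inj_on \<pi> {1..n}"
  proof (rule inj_onI)
    fix u v assume "u \<in> {1..n}" "v \<in> {1..n}" "\<pi> u = \<pi> v"
    then have "key u = key v" using mono[of u v] mono[of v u] by (metis less_irrefl linorder_neqE_nat)
    then show "u = v" using assms \<open>u \<in> _\<close> \<open>v \<in> _\<close> by (simp add: inj_on_eq_iff)
  qed
  have sub: "\<pi> ` {1..n} \<subseteq> {1..n}"
  proof safe
    fix v assume v: "v \<in> {1..n}"
    have "card {u \<in> {1..n}. key u \<le> key v} \<le> card {1..n}" by (intro card_mono) auto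
    moreover have "0 < card {u \<in> {1..n}. key u \<le> key v}" using v by (auto simp: card_gt_0_iff)
    ultimately show "\<pi> v \<in> {1..n}" using v by (simp add: \<pi>_def)
  qed
  then have "bij_betw \<pi> {1..n} {1..n}"
    using inj by (simp add: bij_betw_def endo_inj_surj)
  then have \<pi>: "\<pi> permutes {1..n}"
    by (rule bij_imp_permutes) (auto simp: \<pi>_def)
  show thesis
  proof
    show perm: "inv_into UNIV \<pi> permutes {1..n}" using \<pi> by (rule permutes_inv)
    fix i j assume ij: "i \<in> {1..n}" "j \<in> {1..n}" "i < j"
    have m: "inv_into UNIV \<pi> i \<in> {1..n}" "inv_into UNIV \<pi> j \<in> {1..n}" using ij permutes_in_image[OF perm] by blast+
    have e: "\<pi> (inv_into UNIV \<pi> i) = i" "\<pi> (inv_into UNIV \<pi> j) = j" using \<pi> by (simp_all add: permutes_inverses)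
    show "key (inv_into UNIV \<pi> i) < key (inv_into UNIV \<pi> j)"
    proof (rule ccontr)
      assume "\<not> ?thesis"
      moreover have "key (inv_into UNIV \<pi> i) \<noteq> key (inv_into UNIV \<pi> j)"
        using m e ij(3) assms by (metis inj_on_eq_iff less_irrefl)
      ultimately have "key (inv_into UNIV \<pi> j) < key (inv_into UNIV \<pi> i)" by simp
      from mono[OF m(2,1) this] e ij(3) show False by simp
    qed
  qed
qed

lemma sorting_permutation_unique:
  fixes key :: "nat \<Rightarrow> nat"
  assumes "inj_on key {1..n}" "\<sigma> permutes {1..n}" "\<tau> permutes {1..n}"
    and "\<And>i. i \<in> {1..<n} \<Longrightarrow> key (\<sigma> i) < key (\<sigma> (Suc i))"
    and "\<And>i. i \<in> {1..<n} \<Longrightarrow> key (\<tau> i) < key (\<tau> (Suc i))"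
  shows "\<sigma> = \<tau>"
proof -
  have sorted: "sorted (map (key \<circ> \<rho>) [1..<Suc n]) \<and> distinct (map (key \<circ> \<rho>) [1..<Suc n]) \<and>
      set (map (key \<circ> \<rho>) [1..<Suc n]) = key ` {1..n}"
    if \<rho>: "\<rho> permutes {1..n}" and step: "\<And>i. i \<in> {1..<n} \<Longrightarrow> key (\<rho> i) < key (\<rho> (Suc i))" for \<rho>
  proof (intro conjI)
    have "sorted_wrt (<) (map (key \<circ> \<rho>) [1..<Suc n])"
      using step by (subst sorted_wrt_iff_nth_Suc_transp) (auto simp del: upt_Suc)
    then show "sorted (map (key \<circ> \<rho>) [1..<Suc n])" "distinct (map (key \<circ> \<rho>) [1..<Suc n])"
      by (auto simp only: strict_sorted_iff)
    show "set (map (key \<circ> \<rho>) [1..<Suc n]) = key ` {1..n}"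
      using permutes_image[OF \<rho>] by (metis atLeastLessThanSuc_atLeastAtMost image_comp set_map set_upt)
  qed
  have eq: "map (key \<circ> \<sigma>) [1..<Suc n] = map (key \<circ> \<tau>) [1..<Suc n]"
    using sorted[OF assms(2,4)] sorted[OF assms(3,5)] by (intro sorted_distinct_set_unique) auto
  have "\<sigma> i = \<tau> i" for i
  proof (cases "i \<in> {1..n}")
    case True
    then have "key (\<sigma> i) = key (\<tau> i)" using eq by auto
    then show ?thesis using True assms(1) permutes_in_image[OF assms(2)] permutes_in_image[OF assms(3)]
      by (metis inj_on_eq_iff)
  next
    case False
    then show ?thesis using assms(2,3) by (simp add: permutes_not_in)
  qed
  then show ?thesis by auto
qed

section \<open>Labelings and permutations whose barred descents lie at block boundaries\<close>

context
  fixes n :: nat and b :: "nat \<Rightarrow> nat"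
  assumes mono: "mono_on {1..n} b"
begin

text \<open>The least value of a block cannot sit at an excedance position of the same block, which
  would have to be smaller. This is the origin of the factor \<open>L_C - t * x_C\<close>.\<close>

abbreviation first_of_block :: "nat \<Rightarrow> bool" where
  "first_of_block v \<equiv> (\<forall>u\<in>{1..n}. u < v \<longrightarrow> b u \<noteq> b v)"

text \<open>The label \<open>2 * B\<close> of a value says that it sits at an excedance position of block \<open>B\<close>, the label
  \<open>2 * B + 1\<close> that it sits at a non-excedance position of block \<open>B\<close>.\<close>

definition labels :: "nat \<Rightarrow> nat set" where
  "labels v = (\<lambda>B. 2 * B) ` {B \<in> b ` {1..n}. B < b v \<or> B = b v \<and> \<not> first_of_block v} \<union>
     (\<lambda>B. 2 * B + 1) ` {B \<in> b ` {1..n}. b v \<le> B}"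

lemma finite_labels [simp]: "finite (labels v)"
  by (simp add: labels_def)

definition label :: "(nat \<Rightarrow> nat) \<Rightarrow> nat \<Rightarrow> nat" where
  "label \<sigma> v = 2 * b (inv_into UNIV \<sigma> v) + (if inv_into UNIV \<sigma> v < v then 0 else 1)"

lemma block_index_mono: "u \<in> {1..n} \<Longrightarrow> v \<in> {1..n} \<Longrightarrow> u \<le> v \<Longrightarrow> b u \<le> b v"
  using mono by (simp add: mono_on_def)

lemma label_in_labels:
  assumes "\<sigma> permutes {1..n}" "v \<in> {1..n}"
  shows "label \<sigma> v \<in> labels v"
proof -
  have "inv_into UNIV \<sigma> v \<in> {1..n}" using permutes_in_image[OF permutes_inv[OF assms(1)]] assms(2) by blast
  then show ?thesis using assms(2) block_index_mono[of "inv_into UNIV \<sigma> v" v] block_index_mono[of v "inv_into UNIV \<sigma> v"]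
    by (auto simp: label_def labels_def image_iff)
qed

lemma label_div_2: "label \<sigma> v div 2 = b (inv_into UNIV \<sigma> v)"
  by (simp add: label_def)

text \<open>Within a block the excedances come first and in increasing order, so the values up to an
  excedance position \<open>i\<close> are distinct, lie above the first position of the block and are at most
  \<open>\<sigma> i\<close>; counting them gives \<open>i < \<sigma> i\<close>.  Non-excedances are treated symmetrically from the end of
  the block.\<close>

lemma even_label_iff:
  assumes \<sigma>: "\<sigma> permutes {1..n}" and g: "\<And>v. v \<in> {1..n} \<Longrightarrow> g v \<in> labels v"
    and sorted: "\<And>i j. i \<in> {1..n} \<Longrightarrow> j \<in> {1..n} \<Longrightarrow> i < j \<Longrightarrow> g (\<sigma> i) < g (\<sigma> j) \<or> g (\<sigma> i) = g (\<sigma> j) \<and> \<sigma> i < \<sigma> j"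
    and div: "\<And>i. i \<in> {1..n} \<Longrightarrow> g (\<sigma> i) div 2 = b i"
    and i: "i \<in> {1..n}"
  shows "even (g (\<sigma> i)) \<longleftrightarrow> i < \<sigma> i"
proof -
  have \<sigma>in: "\<sigma> j \<in> {1..n}" if "j \<in> {1..n}" for j using permutes_in_image[OF \<sigma>] that by blast
  have inj: "inj_on \<sigma> J" for J using permutes_inj[OF \<sigma>] by (rule inj_on_subset) auto
  let ?B = "{u \<in> {1..n}. b u = b i}"
  have B: "finite ?B" "i \<in> ?B" using i by auto
  show ?thesis
  proof (cases "even (g (\<sigma> i))")
    case True
    have "i < \<sigma> i"
    proof (cases "b i < b (\<sigma> i)")
      case True
      then show ?thesis using block_index_mono[OF \<sigma>in[OF i] i] by (meson leI not_less)
    next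
      case False
      define p where "p = Min ?B"
      have p: "p \<in> ?B" "p \<le> i" using B Min_in[OF B(1)] Min_le[OF B] unfolding p_def by blast+
      have gi: "g (\<sigma> i) = 2 * b i" using True div[OF i] by (metis dvd_mult_div_cancel)
      have "\<sigma> ` {p..i} \<subseteq> {Suc p..\<sigma> i}"
      proof safe
        fix j assume j: "j \<in> {p..i}"
        then have jn: "j \<in> {1..n}" using p i by auto
        have bj: "b j = b i" using block_index_mono[of p j] block_index_mono[of j i] p j i jn by auto
        have le: "g (\<sigma> j) < g (\<sigma> i) \<or> g (\<sigma> j) = g (\<sigma> i) \<and> \<sigma> j \<le> \<sigma> i"
          using sorted[OF jn i] j by (cases "j = i") auto
        have "2 * (g (\<sigma> j) div 2) \<le> g (\<sigma> j)" by simp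
        then have gj: "g (\<sigma> j) = 2 * b i" using le gi div[OF jn] bj by simp
        then have \<sigma>j: "\<sigma> j \<le> \<sigma> i" using le gi by auto
        have "b i < b (\<sigma> j) \<or> b i = b (\<sigma> j) \<and> \<not> first_of_block (\<sigma> j)"
          using g[OF \<sigma>in[OF jn]] gj by (auto simp: labels_def) presburger+
        moreover have "b (\<sigma> j) \<le> b i" using block_index_mono[OF \<sigma>in[OF jn] \<sigma>in[OF i] \<sigma>j] False by simp
        ultimately obtain u where "u \<in> {1..n}" "u < \<sigma> j" "b u = b i" by auto
        then have "p \<le> u" using B by (auto simp: p_def)
        with \<open>u < \<sigma> j\<close> \<sigma>j show "\<sigma> j \<in> {Suc p..\<sigma> i}" by simp
      qed
      from card_mono[OF _ this] have "card {p..i} \<le> card {Suc p..\<sigma> i}"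
        by (simp add: card_image[OF inj])
      then show ?thesis using p(2) by simp
    qed
    with True show ?thesis by simp
  next
    case False
    define q where "q = Max ?B"
    have q: "q \<in> ?B" "i \<le> q" using B Max_in[OF B(1)] Max_ge[OF B] unfolding q_def by blast+
    have gi: "g (\<sigma> i) = 2 * b i + 1" using False div[OF i] by presburger
    have "\<sigma> ` {i..q} \<subseteq> {\<sigma> i..q}"
    proof safe
      fix j assume j: "j \<in> {i..q}"
      then have jn: "j \<in> {1..n}" using q i by auto
      have bj: "b j = b i" using block_index_mono[of i j] block_index_mono[of j q] q j i jn by auto
      have le: "g (\<sigma> i) < g (\<sigma> j) \<or> g (\<sigma> i) = g (\<sigma> j) \<and> \<sigma> i \<le> \<sigma> j"
        using sorted[OF i jn] j by (cases "j = i") auto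
      have gj: "g (\<sigma> j) = 2 * b i + 1" using le gi div[OF jn] bj by presburger
      then have \<sigma>j: "\<sigma> i \<le> \<sigma> j" using le gi by auto
      have "b (\<sigma> j) \<le> b i"
        using g[OF \<sigma>in[OF jn]] gj by (auto simp: labels_def) presburger+
      then have "\<sigma> j \<le> q"
      proof (rule contrapos_pp)
        assume gt: "\<not> \<sigma> j \<le> q"
        then have "\<sigma> j \<notin> ?B" using Max_ge[OF B(1), of "\<sigma> j"] unfolding q_def by blast
        moreover have "b i \<le> b (\<sigma> j)" using block_index_mono[of q "\<sigma> j"] q gt \<sigma>in[OF jn] by auto
        ultimately show "\<not> b (\<sigma> j) \<le> b i" using \<sigma>in[OF jn] by auto
      qed
      with \<sigma>j show "\<sigma> j \<in> {\<sigma> i..q}" by simp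
    qed
    from card_mono[OF _ this] have "card {i..q} \<le> card {\<sigma> i..q}"
      by (simp add: card_image[OF inj])
    then have "\<sigma> i \<le> i" using q(2) by simp
    with False show ?thesis by simp
  qed
qed

definition compatible_perms :: "(nat \<Rightarrow> nat) set" where
  "compatible_perms = {\<sigma>. \<sigma> permutes {1..n} \<and> (\<forall>i\<in>dex_descents n \<sigma>. b i < b (Suc i))}"

text \<open>The inverse sorts the values by label, with ties broken by value. The content condition
  forces each position to receive its own block number, and \<open>even_label_iff\<close> shows that
  the parities record the excedances correctly.\<close>

lemma bij_betw_label:
  "bij_betw (\<lambda>\<sigma>. restrict (label \<sigma>) {1..n}) compatible_perms
     {g. g \<in> PiE {1..n} labels \<and> image_mset (\<lambda>v. g v div 2) (mset_set {1..n}) = image_mset b (mset_set {1..n})}"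
proof (rule bij_betwI')
  fix \<sigma> \<tau> assume \<sigma>\<tau>: "\<sigma> \<in> compatible_perms" "\<tau> \<in> compatible_perms"
  show "(restrict (label \<sigma>) {1..n} = restrict (label \<tau>) {1..n}) = (\<sigma> = \<tau>)"
  proof
    assume eq: "restrict (label \<sigma>) {1..n} = restrict (label \<tau>) {1..n}"
    \<comment> \<open>Encodes the lexicographic order on pairs of label and value, since values are
      below \<open>Suc n\<close>.\<close>
    define key where "key v = label \<sigma> v * Suc n + v" for v
    have key': "key v = label \<tau> v * Suc n + v" if "v \<in> {1..n}" for v
      using fun_cong[OF eq, of v] that by (simp add: key_def)
    have "v = key v mod Suc n" if "v \<in> {1..n}" for v using that by (simp add: key_def del: mult_Suc_right)
    then have inj: "inj_on key {1..n}" by (metis inj_onI)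
    have step: "label \<rho> (\<rho> i) * Suc n + \<rho> i < label \<rho> (\<rho> (Suc i)) * Suc n + \<rho> (Suc i)"
      if \<rho>: "\<rho> \<in> compatible_perms" and i: "i \<in> {1..<n}" for \<rho> i
    proof -
      have perm: "\<rho> permutes {1..n}" using \<rho> by (simp add: compatible_perms_def)
      have lab: "label \<rho> (\<rho> j) = 2 * b j + (if j < \<rho> j then 0 else 1)" for j
        using perm by (simp add: label_def permutes_inverses)
      have rng: "\<rho> i \<in> {1..n}" "\<rho> (Suc i) \<in> {1..n}" using permutes_in_image[OF perm] i by auto
      have ne: "\<rho> i \<noteq> \<rho> (Suc i)" using permutes_inj[OF perm] by (metis injD n_not_Suc_n)
      have le: "b i \<le> b (Suc i)" using block_index_mono[of i "Suc i"] i by auto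
      have "label \<rho> (\<rho> i) < label \<rho> (\<rho> (Suc i)) \<or> label \<rho> (\<rho> i) = label \<rho> (\<rho> (Suc i)) \<and> \<rho> i < \<rho> (Suc i)"
      proof (cases "b i < b (Suc i)")
        case True
        then show ?thesis by (auto simp: lab)
      next
        case False
        then have "b (Suc i) = b i" "i \<notin> dex_descents n \<rho>" using le \<rho> by (auto simp: compatible_perms_def)
        then show ?thesis using i ne by (auto simp: lab dex_descents_def)
      qed
      then show ?thesis
      proof
        assume "label \<rho> (\<rho> i) < label \<rho> (\<rho> (Suc i))"
        then have "Suc (label \<rho> (\<rho> i)) * Suc n \<le> label \<rho> (\<rho> (Suc i)) * Suc n" by (intro mult_right_mono) auto
        then show ?thesis using rng by simp
      qed auto
    qed
    have in_range: "\<sigma> i \<in> {1..n}" "\<tau> i \<in> {1..n}" if "i \<in> {1..n}" for i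
      using \<sigma>\<tau> that permutes_in_image[of \<sigma> "{1..n}" i] permutes_in_image[of \<tau> "{1..n}" i]
      unfolding compatible_perms_def by simp_all
    show "\<sigma> = \<tau>"
    proof (rule sorting_permutation_unique[OF inj])
      show "\<sigma> permutes {1..n}" "\<tau> permutes {1..n}" using \<sigma>\<tau> by (auto simp: compatible_perms_def)
      fix i assume i: "i \<in> {1..<n}"
      show "key (\<sigma> i) < key (\<sigma> (Suc i))" using step[OF \<sigma>\<tau>(1) i] by (simp add: key_def)
      show "key (\<tau> i) < key (\<tau> (Suc i))" using step[OF \<sigma>\<tau>(2) i] in_range[of i] in_range[of "Suc i"] i
        by (simp add: key')
    qed
  qed simp
next
  fix \<sigma> assume "\<sigma> \<in> compatible_perms"
  then have \<sigma>: "\<sigma> permutes {1..n}" by (simp add: compatible_perms_def)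
  have "image_mset (\<lambda>v. restrict (label \<sigma>) {1..n} v div 2) (mset_set {1..n}) = image_mset (b \<circ> inv_into UNIV \<sigma>) (mset_set {1..n})"
    by (intro image_mset_cong) (auto simp: label_div_2)
  also have "\<dots> = image_mset b (mset_set {1..n})"
    by (simp only: multiset.map_comp[symmetric] permutes_image_mset[OF permutes_inv[OF \<sigma>]])
  finally show "restrict (label \<sigma>) {1..n} \<in> {g. g \<in> PiE {1..n} labels \<and>
      image_mset (\<lambda>v. g v div 2) (mset_set {1..n}) = image_mset b (mset_set {1..n})}"
    using label_in_labels[OF \<sigma>] by simp
next
  fix g assume "g \<in> {g. g \<in> PiE {1..n} labels \<and> image_mset (\<lambda>v. g v div 2) (mset_set {1..n}) = image_mset b (mset_set {1..n})}"
  then have gP: "g \<in> PiE {1..n} labels" and content: "image_mset (\<lambda>v. g v div 2) (mset_set {1..n}) = image_mset b (mset_set {1..n})"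
    by auto
  have g: "g v \<in> labels v" if "v \<in> {1..n}" for v using gP that by auto
  define key where "key v = g v * Suc n + v" for v
  have "v = key v mod Suc n" if "v \<in> {1..n}" for v using that by (simp add: key_def del: mult_Suc_right)
  then have inj: "inj_on key {1..n}" by (metis inj_onI)
  obtain \<sigma> where \<sigma>: "\<sigma> permutes {1..n}"
    and lt: "\<And>i j. i \<in> {1..n} \<Longrightarrow> j \<in> {1..n} \<Longrightarrow> i < j \<Longrightarrow> key (\<sigma> i) < key (\<sigma> j)"
    using ex_sorting_permutation[OF inj] by blast
  have \<sigma>in: "\<sigma> i \<in> {1..n}" if "i \<in> {1..n}" for i using permutes_in_image[OF \<sigma>] that by blast
  have sorted: "g (\<sigma> i) < g (\<sigma> j) \<or> g (\<sigma> i) = g (\<sigma> j) \<and> \<sigma> i < \<sigma> j"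
    if "i \<in> {1..n}" "j \<in> {1..n}" "i < j" for i j
  proof (rule ccontr)
    assume a: "\<not> ?thesis"
    have "key (\<sigma> j) \<le> key (\<sigma> i)"
    proof (cases "g (\<sigma> j) < g (\<sigma> i)")
      case True
      then have "Suc (g (\<sigma> j)) * Suc n \<le> g (\<sigma> i) * Suc n" by (intro mult_right_mono) auto
      then show ?thesis using \<sigma>in[OF that(2)] by (simp add: key_def)
    next
      case False
      then show ?thesis using a by (auto simp: key_def)
    qed
    with lt[OF that] show False by simp
  qed
  have div: "g (\<sigma> i) div 2 = b i" if "i \<in> {1..n}" for i
  proof -
    have m: "mset (map f [1..<Suc n]) = image_mset f (mset_set {1..n})" for f :: "nat \<Rightarrow> nat"
      by (simp only: mset_map mset_upt atLeastLessThanSuc_atLeastAtMost)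
    have s: "sorted (map f [1..<Suc n])" if "\<And>i j. i \<in> {1..n} \<Longrightarrow> j \<in> {1..n} \<Longrightarrow> i < j \<Longrightarrow> f i \<le> f j" for f :: "nat \<Rightarrow> nat"
      unfolding sorted_wrt_map using that
      by (intro sorted_wrt_mono_rel[OF _ sorted_wrt_upt]) auto
    have "image_mset (\<lambda>i. g (\<sigma> i) div 2) (mset_set {1..n}) = image_mset b (mset_set {1..n})"
    proof -
      have "image_mset (\<lambda>v. g v div 2) (image_mset \<sigma> (mset_set {1..n})) = image_mset b (mset_set {1..n})"
        using content by (simp only: permutes_image_mset[OF \<sigma>])
      then show ?thesis by (simp only: multiset.map_comp comp_def)
    qed
    moreover have "g (\<sigma> i) div 2 \<le> g (\<sigma> j) div 2" if "i \<in> {1..n}" "j \<in> {1..n}" "i < j" for i j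
      using sorted[OF that] by (auto intro: div_le_mono)
    \<comment> \<open>Both sequences are weakly increasing and have the same content, hence
      coincide.\<close>
    ultimately have "sort (map b [1..<Suc n]) = map (\<lambda>i. g (\<sigma> i) div 2) [1..<Suc n]"
      by (intro properties_for_sort s) (simp_all only: m)
    moreover have "sort (map b [1..<Suc n]) = map b [1..<Suc n]"
      using block_index_mono by (intro sorted_sort_id s) auto
    ultimately show ?thesis using that by (auto simp del: upt_Suc)
  qed
  have exc: "even (g (\<sigma> i)) \<longleftrightarrow> i < \<sigma> i" if "i \<in> {1..n}" for i
    by (rule even_label_iff[OF \<sigma> g sorted div that])
  have val: "g (\<sigma> i) = 2 * b i + (if i < \<sigma> i then 0 else 1)" if "i \<in> {1..n}" for i
    using exc[OF that] div[OF that] by presburger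
  have "\<sigma> \<in> compatible_perms"
    unfolding compatible_perms_def mem_Collect_eq
  proof (intro conjI \<sigma> ballI)
    fix i assume i: "i \<in> dex_descents n \<sigma>"
    then have r: "i \<in> {1..n}" "Suc i \<in> {1..n}" by (auto simp: dex_descents_def)
    have "b i \<le> b (Suc i)" using block_index_mono[OF r] by simp
    moreover have "b i \<noteq> b (Suc i)"
      using i sorted[OF r] val[OF r(1)] val[OF r(2)] by (auto simp: dex_descents_def split: if_splits)
    ultimately show "b i < b (Suc i)" by simp
  qed
  moreover have "g = restrict (label \<sigma>) {1..n}"
  proof
    fix v
    show "g v = restrict (label \<sigma>) {1..n} v"
    proof (cases "v \<in> {1..n}")
      case True
      then have "inv_into UNIV \<sigma> v \<in> {1..n}" using permutes_in_image[OF permutes_inv[OF \<sigma>]] by blast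
      from val[OF this] True show ?thesis using \<sigma> by (simp add: label_def permutes_inverses)
    next
      case False
      then show ?thesis using PiE_arb[OF gP False] by (simp only: restrict_def if_False)
    qed
  qed
  ultimately show "\<exists>\<sigma>\<in>compatible_perms. g = restrict (label \<sigma>) {1..n}" by blast
qed

lemma prod_label:
  assumes "\<sigma> permutes {1..n}"
  shows "(\<Prod>v\<in>{1..n}. if even (label \<sigma> v) then t else 1) = (t::'a::comm_ring_1) ^ exc n \<sigma>"
proof -
  have "(\<Prod>v\<in>{1..n}. if even (label \<sigma> v) then t else 1) = (\<Prod>i\<in>{1..n}. if even (label \<sigma> (\<sigma> i)) then t else 1)"
    using prod.permute[OF assms, of "\<lambda>v. if even (label \<sigma> v) then t else 1"] by (simp add: comp_def)
  also have "\<dots> = (\<Prod>i\<in>{1..n}. if i < \<sigma> i then t else 1)"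
    using assms by (intro prod.cong) (auto simp: label_def permutes_inverses)
  finally show ?thesis
    by (simp add: prod.inter_filter[symmetric] exc_def)
qed

lemma sum_labels:
  assumes "v \<in> {1..n}"
  shows "(\<Sum>y\<in>labels v. Poly_Mapping.single {#y div 2#} (if even y then t else 1)) =
    block_form (b ` {1..n}) t (b v) - (if first_of_block v then Poly_Mapping.single {#b v#} t else 0)"
proof -
  let ?U = "b ` {1..n}"
  have inj: "inj_on (\<lambda>B. 2 * B) S" "inj_on (\<lambda>B. 2 * B + 1) S" for S :: "nat set"
    by (auto simp: inj_on_def)
  have "(\<Sum>y\<in>labels v. Poly_Mapping.single {#y div 2#} (if even y then t else 1)) =
     (\<Sum>B\<in>{B \<in> ?U. B < b v \<or> B = b v \<and> \<not> first_of_block v}. Poly_Mapping.single {#B#} t) +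
     (\<Sum>B\<in>{B \<in> ?U. b v \<le> B}. Poly_Mapping.single {#B#} 1)"
  proof -
    have "2 * B \<noteq> Suc (2 * B')" for B B' :: nat by presburger
    then show ?thesis unfolding labels_def
      by (subst sum.union_disjoint) (auto simp: sum.reindex[OF inj(1)] sum.reindex[OF inj(2), simplified])
  qed
  moreover have "{B \<in> ?U. B \<le> b v} = (if first_of_block v then insert (b v) else id) {B \<in> ?U. B < b v \<or> B = b v \<and> \<not> first_of_block v}"
    using assms by auto
  ultimately show ?thesis
    by (auto simp: block_form_def)
qed

text \<open>The labels of different values are chosen independently, so the generating function is a
  product of one linear form per value. Each block has exactly one first value, so grouping by
  blocks yields \<open>block_factor\<close>.\<close>

lemma sum_compatible_perms:
  "(\<Sum>\<sigma>\<in>compatible_perms. (t::'a::comm_ring_1) ^ exc n \<sigma>) = exc_coeff t (image_mset b (mset_set {1..n}))"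
proof -
  let ?\<mu> = "image_mset b (mset_set {1..n})" and ?U = "b ` {1..n}"
  let ?w = "\<lambda>y::nat. if even y then t else 1"
  have supp: "set_mset ?\<mu> = ?U" by simp
  have "(\<Sum>\<sigma>\<in>compatible_perms. t ^ exc n \<sigma>) = (\<Sum>\<sigma>\<in>compatible_perms. \<Prod>v\<in>{1..n}. ?w (restrict (label \<sigma>) {1..n} v))"
    by (intro sum.cong refl, subst prod_label[symmetric]) (auto simp: compatible_perms_def)
  also have "\<dots> = (\<Sum>g | g \<in> PiE {1..n} labels \<and> image_mset (\<lambda>v. g v div 2) (mset_set {1..n}) = ?\<mu>. \<Prod>v\<in>{1..n}. ?w (g v))"
    by (rule sum.reindex_bij_betw[OF bij_betw_label])
  also have "\<dots> = Poly_Mapping.lookup (\<Prod>v\<in>{1..n}. \<Sum>y\<in>labels v. Poly_Mapping.single {#y div 2#} (?w y)) ?\<mu>"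
    by (rule lookup_prod_sum_single[symmetric]) auto
  also have "(\<Prod>v\<in>{1..n}. \<Sum>y\<in>labels v. Poly_Mapping.single {#y div 2#} (?w y)) =
     (\<Prod>v\<in>{1..n}. block_form ?U t (b v) - (if first_of_block v then Poly_Mapping.single {#b v#} t else 0))"
    by (intro prod.cong refl sum_labels)
  also have "\<dots> = (\<Prod>C\<in>?U. \<Prod>v\<in>{v \<in> {1..n}. b v = C}. block_form ?U t (b v) - (if first_of_block v then Poly_Mapping.single {#b v#} t else 0))"
    by (rule prod.group[symmetric]) auto
  also have "\<dots> = (\<Prod>C\<in>?U. block_factor (block_form ?U t C) (Poly_Mapping.single {#C#} t) (count ?\<mu> C))"
  proof (intro prod.cong refl)
    fix C assume "C \<in> ?U"
    let ?S = "{v \<in> {1..n}. b v = C}" and ?F = "\<lambda>v. block_form ?U t (b v) - (if first_of_block v then Poly_Mapping.single {#b v#} t else 0)"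
    have S: "finite ?S" "?S \<noteq> {}" using \<open>C \<in> ?U\<close> by auto
    define p where "p = Min ?S"
    have p: "p \<in> ?S" using Min_in[OF S] by (simp add: p_def)
    have le: "p \<le> u" if "u \<in> ?S" for u using S that by (simp add: p_def)
    have "(\<Prod>v\<in>?S. ?F v) = ?F p * (\<Prod>v\<in>?S - {p}. ?F v)" using S p by (simp add: prod.remove)
    also have "(\<Prod>v\<in>?S - {p}. ?F v) = (\<Prod>v\<in>?S - {p}. block_form ?U t C)"
    proof (intro prod.cong refl)
      fix v assume v: "v \<in> ?S - {p}"
      then have "p < v" using le[of v] by auto
      then have "\<not> first_of_block v" using p v by auto
      then show "?F v = block_form ?U t C" using v by auto
    qed
    also have "\<dots> = block_form ?U t C ^ (card ?S - 1)" using p S by simp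
    also have "?F p = block_form ?U t C - Poly_Mapping.single {#C#} t"
    proof -
      have "first_of_block p" using le p by fastforce
      then show ?thesis using p by auto
    qed
    finally show "(\<Prod>v\<in>?S. ?F v) = block_factor (block_form ?U t C) (Poly_Mapping.single {#C#} t) (count ?\<mu> C)"
      using S by (subst count_image_mset_eq_card_vimage) (auto simp: block_factor_def)
  qed
  finally show ?thesis
    unfolding exc_coeff_def block_coeff_def supp .
qed

end

section \<open>The q-Eulerian polynomial as a sum over codes\<close>

definition des :: "nat \<Rightarrow> (nat \<Rightarrow> nat) \<Rightarrow> nat set" where
  "des n \<alpha> = {i \<in> {1..<n}. \<alpha> (Suc i) < \<alpha> i}"

lemma max_letter_ge: "i \<in> {1..n} \<Longrightarrow> \<alpha> i \<le> max_letter n \<alpha>"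
  by (simp add: max_letter_def)

lemma max_letter_le:
  assumes "1 \<le> n" and "\<forall>k\<in>{1..max_letter n \<alpha>}. 2 \<le> card (occurrences n \<alpha> k)"
  shows "max_letter n \<alpha> \<le> n"
proof -
  have "k \<in> \<alpha> ` {1..n}" if "k \<in> {1..max_letter n \<alpha>}" for k
  proof -
    have "occurrences n \<alpha> k \<noteq> {}" using bspec[OF assms(2) that] by auto
    then show ?thesis by (auto simp: occurrences_def)
  qed
  then have "card {1..max_letter n \<alpha>} \<le> card (\<alpha> ` {1..n})" by (intro card_mono) auto
  also have "\<dots> \<le> n" using card_image_le[of "{1..n}" \<alpha>] by simp
  finally show ?thesis by simp
qed

definition code_words :: "nat \<Rightarrow> (nat \<Rightarrow> nat) set" where
  "code_words n = {\<alpha> \<in> {1..n} \<rightarrow>\<^sub>E UNIV. \<forall>k\<in>{1..max_letter n \<alpha>}. 2 \<le> card (occurrences n \<alpha> k)}"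

definition markings :: "nat \<Rightarrow> (nat \<Rightarrow> nat) \<Rightarrow> (nat \<Rightarrow> nat) set" where
  "markings n \<alpha> = (\<Pi>\<^sub>E k \<in> {1..max_letter n \<alpha>}. {1..card (occurrences n \<alpha> k) - 1})"

lemma stembridge_codes_eq_Sigma: "stembridge_codes n = Sigma (code_words n) (markings n)"
  unfolding stembridge_codes_def code_words_def markings_def by blast

lemma finite_markings: "finite (markings n \<alpha>)"
  by (simp add: markings_def finite_PiE)

lemma finite_code_words:
  assumes "1 \<le> n"
  shows "finite (code_words n)"
proof (rule finite_subset)
  show "code_words n \<subseteq> {1..n} \<rightarrow>\<^sub>E {0..n}"
  proof
    fix \<alpha> assume \<alpha>: "\<alpha> \<in> code_words n"
    then have "max_letter n \<alpha> \<le> n" by (intro max_letter_le[OF assms]) (simp add: code_words_def)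
    then have "\<alpha> i \<in> {0..n}" if "i \<in> {1..n}" for i using max_letter_ge[OF that, of \<alpha>] by simp
    then show "\<alpha> \<in> {1..n} \<rightarrow>\<^sub>E {0..n}" using \<alpha> by (simp add: code_words_def PiE_iff)
  qed
qed (simp add: finite_PiE)

lemma finite_stembridge_codes: "1 \<le> n \<Longrightarrow> finite (stembridge_codes n)"
  unfolding stembridge_codes_eq_Sigma by (intro finite_SigmaI finite_code_words finite_markings)

lemma sum_markings:
  "(\<Sum>f\<in>markings n \<alpha>. t ^ code_index n (\<alpha>, f)) =
   (\<Prod>k\<in>{1..max_letter n \<alpha>}. mark_weight t (card (occurrences n \<alpha> k)))"
  by (simp add: markings_def code_index_def power_sum mark_weight_def prod_sum_PiE)

text \<open>Summing over the markings gives each word a product of mark weights; grouping words by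
  their largest letter \<open>m\<close> gives the layers.\<close>

lemma sum_code_words_monotone:
  fixes t :: "'a::comm_ring_1"
  assumes "1 \<le> n"
  shows "(\<Sum>x | x \<in> stembridge_codes n \<and> (\<forall>u\<in>{1..n}. \<forall>v\<in>{1..n}. u < v \<and> b u = b v \<longrightarrow> fst x u \<le> fst x v). t ^ code_index n x)
     = code_coeff t (image_mset b (mset_set {1..n}))"
proof -
  let ?M = "\<lambda>\<alpha>. \<forall>u\<in>{1..n}. \<forall>v\<in>{1..n}. u < v \<and> b u = b v \<longrightarrow> \<alpha> u \<le> \<alpha> v"
  define A where "A = {\<alpha> \<in> code_words n. ?M \<alpha>}"
  have fin: "finite A" using finite_code_words[OF assms] by (simp add: A_def)
  have maxA: "max_letter n \<alpha> \<le> n" if "\<alpha> \<in> A" for \<alpha>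
    using that max_letter_le[OF assms] by (auto simp: A_def code_words_def)
  let ?W = "\<lambda>m \<alpha>. \<Prod>k\<in>{1..m}. mark_weight t (card {v \<in> {1..n}. \<alpha> v = k})"
  have layer: "(\<Sum>\<alpha>\<in>{\<alpha> \<in> A. max_letter n \<alpha> = m}. ?W (max_letter n \<alpha>) \<alpha>) = layer_sum t m (image_mset b (mset_set {1..n}))" for m
  proof -
    have "(\<Sum>\<alpha>\<in>{\<alpha> \<in> A. max_letter n \<alpha> = m}. ?W (max_letter n \<alpha>) \<alpha>) = (\<Sum>\<alpha>\<in>{\<alpha> \<in> A. max_letter n \<alpha> = m}. ?W m \<alpha>)"
      by (intro sum.cong) auto
    also have "\<dots> = (\<Sum>\<alpha>\<in>block_words b {1..n} m. ?W m \<alpha>)"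
    proof (rule sum.mono_neutral_left)
      show "finite (block_words b {1..n} m)" by (simp add: finite_block_words)
      show "{\<alpha> \<in> A. max_letter n \<alpha> = m} \<subseteq> block_words b {1..n} m"
      proof
        fix \<alpha> assume \<alpha>: "\<alpha> \<in> {\<alpha> \<in> A. max_letter n \<alpha> = m}"
        then have "\<alpha> i \<le> m" if "i \<in> {1..n}" for i using max_letter_ge[OF that, of \<alpha>] by simp
        then show "\<alpha> \<in> block_words b {1..n} m"
          using \<alpha> by (simp add: A_def block_words_def code_words_def PiE_iff)
      qed
      \<comment> \<open>A word in which some letter from 1 to \<open>m\<close> occurs at most once
        has weight 0; all other block words are code words with largest letter exactly
        \<open>m\<close>.\<close>
      show "\<forall>\<alpha>\<in>block_words b {1..n} m - {\<alpha> \<in> A. max_letter n \<alpha> = m}. ?W m \<alpha> = 0"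
      proof (rule ballI, rule ccontr)
        fix \<alpha> assume \<alpha>: "\<alpha> \<in> block_words b {1..n} m - {\<alpha> \<in> A. max_letter n \<alpha> = m}" and nz: "?W m \<alpha> \<noteq> 0"
        have two: "2 \<le> card (occurrences n \<alpha> k)" if k: "k \<in> {1..m}" for k
        proof (rule ccontr)
          assume "\<not> ?thesis"
          then have "mark_weight t (card {v \<in> {1..n}. \<alpha> v = k}) = 0"
            unfolding occurrences_def by (intro mark_weight_le_1) linarith
          with k have "?W m \<alpha> = 0" by (intro prod_zero) auto
          with nz show False by contradiction
        qed
        have le: "\<alpha> i \<le> m" if "i \<in> {1..n}" for i using \<alpha> that by (auto simp: block_words_def)
        have "m \<in> \<alpha> ` {1..n}"
        proof (cases "m = 0")
          case True
          then have "\<alpha> 1 = m" using le[of 1] assms by simp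
          then show ?thesis using assms by (intro image_eqI[of _ _ 1]) auto
        next
          case False
          then have "occurrences n \<alpha> m \<noteq> {}" using two[of m] by (auto dest!: arg_cong[of _ "{}" card])
          then show ?thesis by (auto simp: occurrences_def)
        qed
        then have "max_letter n \<alpha> = m" unfolding max_letter_def using le by (intro Max_eqI) auto
        then have "\<alpha> \<in> A" using \<alpha> two by (simp add: A_def code_words_def block_words_def PiE_iff)
        with \<alpha> \<open>max_letter n \<alpha> = m\<close> show False by simp
      qed
    qed
    also have "\<dots> = layer_sum t m (image_mset b (mset_set {1..n}))"
      by (rule sum_block_words) simp
    finally show ?thesis .
  qed
  have "{x. x \<in> stembridge_codes n \<and> ?M (fst x)} = Sigma A (markings n)"
    by (auto simp: stembridge_codes_eq_Sigma A_def)
  then have "(\<Sum>x | x \<in> stembridge_codes n \<and> ?M (fst x). t ^ code_index n x) = (\<Sum>\<alpha>\<in>A. \<Sum>f\<in>markings n \<alpha>. t ^ code_index n (\<alpha>, f))"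
    using fin finite_markings by (subst sum.Sigma) auto
  also have "\<dots> = (\<Sum>\<alpha>\<in>A. ?W (max_letter n \<alpha>) \<alpha>)"
    by (simp only: sum_markings occurrences_def)
  also have "\<dots> = (\<Sum>m\<in>{..n}. \<Sum>\<alpha>\<in>{\<alpha> \<in> A. max_letter n \<alpha> = m}. ?W (max_letter n \<alpha>) \<alpha>)"
    using fin maxA by (intro sum.group[symmetric]) auto
  also have "\<dots> = (\<Sum>m\<le>n. layer_sum t m (image_mset b (mset_set {1..n})))"
    by (simp only: layer)
  also have "\<dots> = code_coeff t (image_mset b (mset_set {1..n}))"
    by (simp add: code_coeff_def)
  finally show ?thesis .
qed

section \<open>From words monotone on blocks to descent sets\<close>

lemma des_subset_iff:
  fixes b :: "nat \<Rightarrow> nat"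
  assumes mono: "mono_on {1..n} b" and S: "\<And>i. i \<in> {1..<n} \<Longrightarrow> b i < b (Suc i) \<longleftrightarrow> i \<in> S"
  shows "des n \<alpha> \<subseteq> S \<longleftrightarrow> (\<forall>u\<in>{1..n}. \<forall>v\<in>{1..n}. u < v \<and> b u = b v \<longrightarrow> \<alpha> u \<le> \<alpha> v)"
proof
  have b: "b u \<le> b v" if "u \<in> {1..n}" "v \<in> {1..n}" "u \<le> v" for u v
    using mono that by (simp add: mono_on_def)
  {
    assume des: "des n \<alpha> \<subseteq> S"
    show "\<forall>u\<in>{1..n}. \<forall>v\<in>{1..n}. u < v \<and> b u = b v \<longrightarrow> \<alpha> u \<le> \<alpha> v"
    proof (intro ballI impI)
      fix u v assume uv: "u \<in> {1..n}" "v \<in> {1..n}" "u < v \<and> b u = b v"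
      have step: "\<alpha> i \<le> \<alpha> (Suc i)" if "u \<le> i" "i < v" for i
      proof -
        have "b u \<le> b i" "b (Suc i) \<le> b v" using uv that b[of u i] b[of "Suc i" v] by auto
        then have "\<not> b i < b (Suc i)" using conjunct2[OF uv(3)] by linarith
        then have "i \<notin> des n \<alpha>" using S[of i] des uv that by auto
        then show ?thesis using uv that by (auto simp: des_def)
      qed
      have "w \<le> v \<longrightarrow> \<alpha> u \<le> \<alpha> w" if "u \<le> w" for w
        using that
      proof (induction w rule: dec_induct)
        case (step w)
        then show ?case using \<open>\<And>i. u \<le> i \<Longrightarrow> i < v \<Longrightarrow> \<alpha> i \<le> \<alpha> (Suc i)\<close>[of w] by auto
      qed simp
      then show "\<alpha> u \<le> \<alpha> v" using uv by simp
    qed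
  next
    assume *: "\<forall>u\<in>{1..n}. \<forall>v\<in>{1..n}. u < v \<and> b u = b v \<longrightarrow> \<alpha> u \<le> \<alpha> v"
    show "des n \<alpha> \<subseteq> S"
    proof
      fix i assume i: "i \<in> des n \<alpha>"
      then have "b i \<noteq> b (Suc i)" using *[rule_format, of i "Suc i"] by (auto simp: des_def)
      moreover have "b i \<le> b (Suc i)" using i by (intro b) (auto simp: des_def)
      ultimately show "i \<in> S" using S[of i] i by (auto simp: des_def)
    qed
  }
qed

lemma card_eq_coeff_sum_power:
  assumes "finite X"
  shows "int (card {x \<in> X. h x = j}) = coeff (\<Sum>x\<in>X. monom 1 1 ^ h x) j"
proof -
  have "monom (1::int) 1 ^ k = monom 1 k" for k by (simp add: monom_power)
  then show ?thesis using assms by (simp add: coeff_sum sum.inter_filter[symmetric])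
qed

text \<open>Both counts are the coefficients of \<open>t ^ j\<close> in one identity of integer
  polynomials; the variable itself serves as \<open>t\<close>, so it differs from 1.\<close>

lemma card_descents_subset_eq:
  assumes n: "1 \<le> n" and S: "S \<subseteq> {1..<n}"
  shows "card {\<sigma> \<in> {\<sigma>. \<sigma> permutes {1..n} \<and> exc n \<sigma> = j}. dex_descents n \<sigma> \<subseteq> S} =
         card {x \<in> Code n j. des n (fst x) \<subseteq> S}"
proof -
  \<comment> \<open>Numbers the blocks cut out by \<open>S\<close>: it jumps between
    \<open>i\<close> and \<open>Suc i\<close> exactly when \<open>i\<close> is in
    \<open>S\<close>.\<close>
  define b where "b i = card {s \<in> S. s < i}" for i
  have finS: "finite S" using S by (rule finite_subset) simp
  have mono: "mono_on {1..n} b"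
    unfolding b_def using finS by (intro mono_onI card_mono) auto
  have b: "b i < b (Suc i) \<longleftrightarrow> i \<in> S" for i
  proof -
    have "{s \<in> S. s < Suc i} = (if i \<in> S then insert i {s \<in> S. s < i} else {s \<in> S. s < i})"
      by (auto simp: less_Suc_eq)
    then show ?thesis using finS by (simp add: b_def)
  qed
  have perms: "compatible_perms n b = {\<sigma>. \<sigma> permutes {1..n} \<and> dex_descents n \<sigma> \<subseteq> S}"
    by (auto simp: compatible_perms_def[OF mono] b)
  let ?X = "{x. x \<in> stembridge_codes n \<and> des n (fst x) \<subseteq> S}"
  let ?t = "monom 1 1 :: int poly"
  have "?t \<noteq> 1" by (simp add: monom_eq_1_iff)
  then have "(\<Sum>\<sigma>\<in>compatible_perms n b. ?t ^ exc n \<sigma>) = code_coeff ?t (image_mset b (mset_set {1..n}))"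
    by (simp add: sum_compatible_perms[OF mono] exc_coeff_eq_code_coeff)
  also have "\<dots> = (\<Sum>x\<in>?X. ?t ^ code_index n x)"
    using sum_code_words_monotone[OF n, of ?t b] des_subset_iff[OF mono b] by simp
  finally have eq: "(\<Sum>\<sigma>\<in>compatible_perms n b. ?t ^ exc n \<sigma>) = (\<Sum>x\<in>?X. ?t ^ code_index n x)" .
  have "finite (compatible_perms n b)"
    unfolding perms by (rule finite_subset[OF _ finite_permutations[of "{1..n}"]]) auto
  then have "int (card {\<sigma> \<in> compatible_perms n b. exc n \<sigma> = j}) = int (card {x \<in> ?X. code_index n x = j})"
    using finite_stembridge_codes[OF n] eq by (simp only: card_eq_coeff_sum_power finite_Collect_conjI simp_thms Collect_mem_eq)
  moreover have "{\<sigma> \<in> compatible_perms n b. exc n \<sigma> = j} = {\<sigma> \<in> {\<sigma>. \<sigma> permutes {1..n} \<and> exc n \<sigma> = j}. dex_descents n \<sigma> \<subseteq> S}"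
    "{x \<in> ?X. code_index n x = j} = {x \<in> Code n j. des n (fst x) \<subseteq> S}"
    by (auto simp: perms Code_def)
  ultimately show ?thesis by simp
qed

text \<open>Inclusion-exclusion in inductive form: the counts for proper subsets of \<open>S\<close>
  agree and are subtracted.\<close>

lemma card_eq_from_card_subset:
  assumes fin: "finite X" "finite Y" and "finite U"
    and eq: "\<And>S. S \<subseteq> U \<Longrightarrow> card {x \<in> X. D x \<subseteq> S} = card {y \<in> Y. E y \<subseteq> S}"
    and "S \<subseteq> U"
  shows "card {x \<in> X. D x = S} = card {y \<in> Y. E y = S}"
proof -
  have "finite S" using assms by (simp add: finite_subset)
  then show ?thesis using \<open>S \<subseteq> U\<close>
  proof (induction S rule: finite_psubset_induct)
    case (psubset S)
    have split: "card {x \<in> X. D x \<subseteq> S} = card {x \<in> X. D x = S} + (\<Sum>T\<in>Pow S - {S}. card {x \<in> X. D x = T})"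
      if "finite X" for X :: "'z set" and D
    proof -
      have "{x \<in> X. D x \<subseteq> S} = (\<Union>T\<in>Pow S. {x \<in> X. D x = T})" by auto
      moreover have "card (\<Union>T\<in>Pow S. {x \<in> X. D x = T}) = (\<Sum>T\<in>Pow S. card {x \<in> X. D x = T})"
        using that psubset(1) by (intro card_UN_disjoint) auto
      ultimately show ?thesis using psubset(1) by (simp add: sum.remove[of "Pow S" S])
    qed
    have "(\<Sum>T\<in>Pow S - {S}. card {x \<in> X. D x = T}) = (\<Sum>T\<in>Pow S - {S}. card {y \<in> Y. E y = T})"
      using psubset by (intro sum.cong refl) auto
    then show ?case using eq[OF psubset(3)] split[OF fin(1), of D] split[OF fin(2), of E] by simp
  qed
qed

lemma sum_by_value:
  fixes F :: "'b set \<Rightarrow> 'a::comm_semiring_1"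
  assumes "finite X" "finite U" "\<And>x. x \<in> X \<Longrightarrow> D x \<subseteq> U"
  shows "(\<Sum>x\<in>X. F (D x)) = (\<Sum>S\<in>Pow U. of_nat (card {x \<in> X. D x = S}) * F S)"
proof -
  have "(\<Sum>x\<in>X. F (D x)) = (\<Sum>S\<in>Pow U. \<Sum>x\<in>{x \<in> X. D x = S}. F (D x))"
    using assms by (intro sum.group[symmetric]) auto
  also have "\<dots> = (\<Sum>S\<in>Pow U. of_nat (card {x \<in> X. D x = S}) * F S)"
    by (intro sum.cong refl) simp
  finally show ?thesis .
qed

lemma sum_eq_from_card_subset:
  fixes F :: "'b set \<Rightarrow> 'a::comm_semiring_1"
  assumes fin: "finite X" "finite Y" "finite U"
    and sub: "\<And>x. x \<in> X \<Longrightarrow> D x \<subseteq> U" "\<And>y. y \<in> Y \<Longrightarrow> E y \<subseteq> U"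
    and eq: "\<And>S. S \<subseteq> U \<Longrightarrow> card {x \<in> X. D x \<subseteq> S} = card {y \<in> Y. E y \<subseteq> S}"
  shows "(\<Sum>x\<in>X. F (D x)) = (\<Sum>y\<in>Y. F (E y))"
proof -
  have "(\<Sum>x\<in>X. F (D x)) = (\<Sum>S\<in>Pow U. of_nat (card {x \<in> X. D x = S}) * F S)"
    using fin sub by (intro sum_by_value) auto
  also have "\<dots> = (\<Sum>S\<in>Pow U. of_nat (card {y \<in> Y. E y = S}) * F S)"
    using card_eq_from_card_subset[OF fin eq] by (intro sum.cong refl) auto
  also have "\<dots> = (\<Sum>y\<in>Y. F (E y))"
    using fin sub by (intro sum_by_value[symmetric]) auto
  finally show ?thesis .
qed

lemma q_Eulerian_coeff_eq_sum_codes: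
  assumes "1 \<le> n"
  shows "q_Eulerian_coeff n j = (\<Sum>x\<in>Code n j. monom 1 (\<Sum>(des n (fst x))))"
proof -
  let ?X = "{\<sigma>. \<sigma> permutes {1..n} \<and> exc n \<sigma> = j}"
  have fin: "finite ?X" "finite (Code n j)" "finite {1..<n}"
    using finite_stembridge_codes[OF assms] by (auto simp: Code_def finite_permutations)
  have "q_Eulerian_coeff n j = (\<Sum>\<sigma> | \<sigma> permutes {1..n}. if exc n \<sigma> = j then monom 1 (maj n \<sigma> - exc n \<sigma>) else 0)"
    by (simp add: q_Eulerian_coeff_def q_Eulerian_def coeff_sum del: One_nat_def)
  also have "\<dots> = (\<Sum>\<sigma>\<in>?X. monom 1 (maj n \<sigma> - exc n \<sigma>))"
    by (subst sum.inter_filter[symmetric]) (auto simp: finite_permutations)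
  also have "\<dots> = (\<Sum>\<sigma>\<in>?X. monom 1 (\<Sum>(dex_descents n \<sigma>)))"
    by (intro sum.cong refl) (simp add: maj_eq_sum_dex_descents)
  also have "\<dots> = (\<Sum>x\<in>Code n j. monom 1 (\<Sum>(des n (fst x))))"
    using card_descents_subset_eq[OF assms]
    by (intro sum_eq_from_card_subset[OF fin, of _ _ "\<lambda>S. monom 1 (\<Sum>S)"]) (auto simp: dex_descents_def des_def)
  finally show ?thesis .
qed

section \<open>The major index at roots of unity\<close>

text \<open>With \<open>g = w / (z - 1)\<close> the relation reads
  \<open>w (\<rho> y) = g y - g (\<rho> y)\<close>, and such differences sum to 0 because
  \<open>\<rho>\<close> permutes \<open>Y\<close>. No decomposition into orbits is involved.\<close>

lemma sum_eq_0_of_twisted_permutation: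
  fixes w z :: "'x \<Rightarrow> 'a::field"
  assumes "finite Y" "inj_on \<rho> Y" "\<rho> ` Y \<subseteq> Y"
    and "\<And>y. y \<in> Y \<Longrightarrow> w (\<rho> y) * z y = w y" "\<And>y. y \<in> Y \<Longrightarrow> z (\<rho> y) = z y" "\<And>y. y \<in> Y \<Longrightarrow> z y \<noteq> 1"
  shows "(\<Sum>y\<in>Y. w y) = 0"
proof -
  have surj: "\<rho> ` Y = Y" using assms(1-3) by (intro endo_inj_surj)
  have reindex: "(\<Sum>y\<in>Y. g (\<rho> y)) = (\<Sum>y\<in>Y. g y)" for g :: "'x \<Rightarrow> 'a"
    using sum.reindex[OF assms(2), of g] by (simp add: surj comp_def)
  have "w (\<rho> y) = w y / (z y - 1) - w (\<rho> y) / (z (\<rho> y) - 1)" if "y \<in> Y" for y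
  proof -
    have "w y - w (\<rho> y) = w (\<rho> y) * (z y - 1)" using assms(4)[OF that] by (simp add: right_diff_distrib)
    then have "w (\<rho> y) = (w y - w (\<rho> y)) / (z y - 1)" using assms(6)[OF that] by simp
    then show ?thesis by (simp add: assms(5)[OF that] diff_divide_distrib)
  qed
  then have "(\<Sum>y\<in>Y. w (\<rho> y)) = (\<Sum>y\<in>Y. w y / (z y - 1)) - (\<Sum>y\<in>Y. w (\<rho> y) / (z (\<rho> y) - 1))"
    by (simp add: sum_subtractf[symmetric] cong: sum.cong)
  then show ?thesis using reindex[of w] reindex[of "\<lambda>y. w y / (z y - 1)"] by simp
qed

text \<open>The positions are cut into consecutive blocks of length \<open>d\<close>; \<open>block_next\<close> is the cyclic successor
  within a block.\<close>

definition block_next :: "nat \<Rightarrow> nat \<Rightarrow> nat" where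
  "block_next d p = (if d dvd p then Suc p - d else Suc p)"

lemma block_next:
  assumes "1 \<le> d" "1 \<le> p"
  shows "1 \<le> block_next d p" "(block_next d p - 1) div d = (p - 1) div d"
proof -
  have "1 \<le> block_next d p \<and> (block_next d p - 1) div d = (p - 1) div d"
  proof (cases "d dvd p")
    case True
    then obtain k where k: "p = d * Suc k" using assms by (metis dvdE mult_0_right not0_implies_Suc not_one_le_zero)
    have "(p - 1) div d = k"
      using assms k by (intro div_nat_eqI) (auto simp: algebra_simps)
    moreover have "block_next d p = Suc (d * k)" using assms True k by (auto simp: block_next_def)
    ultimately show ?thesis using assms by simp
  next
    case False
    then have s: "p mod d \<noteq> 0" by (simp add: dvd_eq_mod_eq_0)
    have "(p - 1) div d = p div d"
    proof (rule div_nat_eqI)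
      show "d * (p div d) \<le> p - 1"
        using s mult_div_mod_eq[of d p] by linarith
      show "p - 1 < d * Suc (p div d)"
        using assms dividend_less_times_div[of d p] by simp
    qed
    with False show ?thesis by (simp add: block_next_def)
  qed
  then show "1 \<le> block_next d p" "(block_next d p - 1) div d = (p - 1) div d" by auto
qed

lemma block_next_le:
  assumes "1 \<le> d" "d dvd n" "p \<le> n"
  shows "block_next d p \<le> n"
proof (cases "d dvd p")
  case False
  then have "p \<noteq> n" using assms by auto
  with False assms show ?thesis by (simp add: block_next_def)
qed (use assms in \<open>simp add: block_next_def\<close>)

lemma inj_on_block_next:
  assumes "1 \<le> d"
  shows "inj_on (block_next d) {1..}"
proof (rule inj_onI)
  fix p q assume pq: "p \<in> {1..}" "q \<in> {1..}" "block_next d p = block_next d q"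
  then have le: "d \<le> p" if "d dvd p" using that by (auto intro: dvd_imp_le)
  have le': "d \<le> q" if "d dvd q" using pq that by (auto intro: dvd_imp_le)
  show "p = q"
  proof (cases "d dvd p \<longleftrightarrow> d dvd q")
    case True
    then show ?thesis using pq(3) le le' by (auto simp: block_next_def split: if_splits)
  next
    case False
    then have "p = q + d \<or> q = p + d" using pq(3) le le' by (auto simp: block_next_def split: if_splits)
    with False show ?thesis by auto
  qed
qed

section \<open>Rotating a single block of positions\<close>

context
  fixes n d :: nat
  assumes d: "1 \<le> d" and dvd: "d dvd n"
begin

definition position_block :: "nat \<Rightarrow> nat set" where
  "position_block i = {p \<in> {1..n}. (p - 1) div d = i}"

lemma finite_position_block [simp]: "finite (position_block i)"
  by (simp add: position_block_def)

lemma position_block_subset: "position_block i \<subseteq> {1..n}"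
  by (auto simp: position_block_def)

lemma block_next_mem_iff:
  assumes "p \<in> {1..n}"
  shows "block_next d p \<in> position_block i \<longleftrightarrow> p \<in> position_block i"
  using assms block_next[OF d, of p] block_next_le[OF d dvd, of p] by (auto simp: position_block_def)

lemma block_next_in_block: "p \<in> position_block i \<Longrightarrow> block_next d p \<in> position_block i"
  using block_next_mem_iff position_block_subset by blast

lemma bij_betw_block_next: "bij_betw (block_next d) (position_block i) (position_block i)"
proof -
  have "inj_on (block_next d) (position_block i)"
    using inj_on_block_next[OF d] by (rule inj_on_subset) (auto simp: position_block_def)
  moreover from this have "block_next d ` position_block i = position_block i"
    using block_next_in_block by (intro endo_inj_surj) auto
  ultimately show ?thesis by (simp add: bij_betw_def)
qed

definition rotate_block :: "nat \<Rightarrow> nat \<Rightarrow> nat" where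
  "rotate_block i p = (if p \<in> position_block i then block_next d p else p)"

lemma rotate_block_permutes: "rotate_block i permutes {1..n}"
proof (rule bij_imp_permutes)
  have "bij_betw (rotate_block i) (position_block i) (position_block i)"
    using bij_betw_block_next by (subst bij_betw_cong[of _ _ "block_next d"]) (auto simp: rotate_block_def)
  moreover have "bij_betw (rotate_block i) ({1..n} - position_block i) ({1..n} - position_block i)"
    by (subst bij_betw_cong[of _ _ id]) (auto simp: rotate_block_def)
  ultimately have "bij_betw (rotate_block i) (position_block i \<union> ({1..n} - position_block i)) (position_block i \<union> ({1..n} - position_block i))"
    by (rule bij_betw_combine) auto
  moreover have "position_block i \<union> ({1..n} - position_block i) = {1..n}"
    using position_block_subset by blast
  ultimately show "bij_betw (rotate_block i) {1..n} {1..n}" by simp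
qed (auto simp: rotate_block_def position_block_def)

text \<open>The cyclic descents of the block: its last position is compared with its first.\<close>

definition block_descents :: "nat \<Rightarrow> (nat \<Rightarrow> nat) \<Rightarrow> nat set" where
  "block_descents i \<alpha> = {p \<in> position_block i. \<alpha> (block_next d p) < \<alpha> p}"

lemma rotate_block_next:
  assumes "p \<in> {1..n}"
  shows "rotate_block i (block_next d p) = block_next d (rotate_block i p)"
  using block_next_mem_iff[OF assms] by (simp add: rotate_block_def)

text \<open>Descents at block boundaries sit at multiples of \<open>d\<close> and are invisible to \<open>\<zeta>\<close>; for the same
  reason it is harmless to add the cyclic descents at the last positions of the blocks.\<close>

lemma power_sum_des:
  fixes \<zeta> :: "'a::comm_ring_1"
  assumes "\<zeta> ^ d = 1"
  shows "\<zeta> ^ \<Sum>(des n \<alpha>) = (\<Prod>p\<in>{1..n}. if \<alpha> (block_next d p) < \<alpha> p then \<zeta> ^ p else 1)"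
proof -
  have "\<zeta> ^ \<Sum>(des n \<alpha>) = (\<Prod>p\<in>des n \<alpha>. \<zeta> ^ p)"
    by (simp add: power_sum)
  also have "\<dots> = (\<Prod>p\<in>{1..<n}. if \<alpha> (Suc p) < \<alpha> p then \<zeta> ^ p else 1)"
    unfolding des_def by (rule prod.inter_filter) simp
  also have "\<dots> = (\<Prod>p\<in>{1..<n}. if \<alpha> (block_next d p) < \<alpha> p then \<zeta> ^ p else 1)"
    using assms by (intro prod.cong) (auto simp: block_next_def power_mult elim!: dvdE)
  also have "\<dots> = (\<Prod>p\<in>{1..n}. if \<alpha> (block_next d p) < \<alpha> p then \<zeta> ^ p else 1)"
    using assms dvd by (intro prod.mono_neutral_left) (auto simp: power_mult elim!: dvdE)
  finally show ?thesis .
qed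

lemma block_descents_rotate: "card (block_descents i (\<alpha> \<circ> rotate_block i)) = card (block_descents i \<alpha>)"
proof -
  have "block_next d ` block_descents i (\<alpha> \<circ> rotate_block i) = block_descents i \<alpha>"
  proof (intro equalityI subsetI)
    fix p assume "p \<in> block_next d ` block_descents i (\<alpha> \<circ> rotate_block i)"
    then show "p \<in> block_descents i \<alpha>"
      using block_next_in_block by (auto simp: block_descents_def rotate_block_def)
  next
    fix p assume p: "p \<in> block_descents i \<alpha>"
    then have "p \<in> position_block i" by (simp add: block_descents_def)
    then obtain q where q: "q \<in> position_block i" "p = block_next d q"
      using bij_betw_block_next[of i] by (metis (no_types, lifting) bij_betw_imp_surj_on imageE)
    moreover have "q \<in> block_descents i (\<alpha> \<circ> rotate_block i)"
      using p q block_next_in_block[OF q(1)] by (simp add: block_descents_def rotate_block_def)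
    ultimately show "p \<in> block_next d ` block_descents i (\<alpha> \<circ> rotate_block i)" by blast
  qed
  moreover have "inj_on (block_next d) (block_descents i (\<alpha> \<circ> rotate_block i))"
    using inj_on_block_next[OF d] by (rule inj_on_subset) (auto simp: block_descents_def position_block_def)
  ultimately show ?thesis using card_image by metis
qed

lemma power_block_next:
  fixes \<zeta> :: "'a::comm_ring_1"
  assumes "\<zeta> ^ d = 1" "1 \<le> p"
  shows "\<zeta> ^ block_next d p = \<zeta> ^ Suc p"
proof (cases "d dvd p")
  case True
  then have "d \<le> p" using assms by (auto intro: dvd_imp_le)
  then have "\<zeta> ^ Suc p = \<zeta> ^ (Suc p - d) * \<zeta> ^ d" by (simp flip: power_add)
  then show ?thesis using True assms by (simp add: block_next_def)
qed (simp add: block_next_def)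

text \<open>Rotation moves every cyclic descent of the block one step back, modulo \<open>d\<close>,
  and so costs one factor \<open>\<zeta>\<close> per cyclic descent.\<close>

lemma power_sum_des_rotate:
  fixes \<zeta> :: "'a::comm_ring_1"
  assumes "\<zeta> ^ d = 1"
  shows "\<zeta> ^ \<Sum>(des n (\<alpha> \<circ> rotate_block i)) * \<zeta> ^ card (block_descents i \<alpha>) = \<zeta> ^ \<Sum>(des n \<alpha>)"
proof -
  let ?B = "position_block i" and ?\<beta> = "\<alpha> \<circ> rotate_block i"
  let ?f = "\<lambda>\<alpha> p. if \<alpha> (block_next d p) < \<alpha> p then \<zeta> ^ p else 1"
  have split: "(\<Prod>p\<in>{1..n}. g p) = (\<Prod>p\<in>{1..n} - ?B. g p) * (\<Prod>p\<in>?B. g p)" for g :: "nat \<Rightarrow> 'a"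
    using position_block_subset by (intro prod.subset_diff) auto
  have "\<zeta> ^ card (block_descents i \<alpha>) = \<zeta> ^ card (block_descents i ?\<beta>)"
    by (simp only: block_descents_rotate)
  also have "\<dots> = (\<Prod>p\<in>?B. if ?\<beta> (block_next d p) < ?\<beta> p then \<zeta> else 1)"
    by (simp add: block_descents_def prod.inter_filter[symmetric])
  finally have "(\<Prod>p\<in>?B. ?f ?\<beta> p) * \<zeta> ^ card (block_descents i \<alpha>) =
      (\<Prod>p\<in>?B. ?f ?\<beta> p * (if ?\<beta> (block_next d p) < ?\<beta> p then \<zeta> else 1))"
    by (simp only: prod.distrib)
  also have "\<dots> = (\<Prod>p\<in>?B. ?f \<alpha> (block_next d p))"
  proof (intro prod.cong refl)
    fix p assume p: "p \<in> ?B"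
    then show "?f ?\<beta> p * (if ?\<beta> (block_next d p) < ?\<beta> p then \<zeta> else 1) = ?f \<alpha> (block_next d p)"
      using block_next_in_block[OF p] power_block_next[OF assms, of p] position_block_subset[of i]
      by (auto simp: rotate_block_def mult.commute)
  qed
  also have "\<dots> = (\<Prod>p\<in>?B. ?f \<alpha> p)"
    by (rule prod.reindex_bij_betw[OF bij_betw_block_next])
  finally have B: "(\<Prod>p\<in>?B. ?f ?\<beta> p) * \<zeta> ^ card (block_descents i \<alpha>) = (\<Prod>p\<in>?B. ?f \<alpha> p)" .
  have "(\<Prod>p\<in>{1..n} - ?B. ?f ?\<beta> p) = (\<Prod>p\<in>{1..n} - ?B. ?f \<alpha> p)"
  proof (intro prod.cong refl)
    fix p assume p: "p \<in> {1..n} - ?B"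
    then show "?f ?\<beta> p = ?f \<alpha> p"
      using rotate_block_next[of p i] by (simp add: rotate_block_def)
  qed
  then show ?thesis
    unfolding power_sum_des[OF assms] split by (simp only: mult.assoc B)
qed

definition constant_on_block :: "nat \<Rightarrow> (nat \<Rightarrow> nat) \<Rightarrow> bool" where
  "constant_on_block i \<alpha> \<longleftrightarrow> (\<forall>p\<in>position_block i. \<alpha> (block_next d p) = \<alpha> p)"

lemma constant_on_block_rotate: "constant_on_block k (\<alpha> \<circ> rotate_block i) \<longleftrightarrow> constant_on_block k \<alpha>"
proof (cases "k = i")
  case True
  have "constant_on_block i (\<alpha> \<circ> rotate_block i) \<longleftrightarrow>
      (\<forall>p\<in>block_next d ` position_block i. \<alpha> (block_next d p) = \<alpha> p)"
    using block_next_in_block by (simp add: constant_on_block_def rotate_block_def)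
  then show ?thesis
    using True bij_betw_imp_surj_on[OF bij_betw_block_next[of i]] by (simp add: constant_on_block_def)
next
  case False
  then have "rotate_block i p = p" if "p \<in> position_block k" for p
    using that by (auto simp: rotate_block_def position_block_def)
  then show ?thesis using block_next_in_block by (simp add: constant_on_block_def)
qed

text \<open>Going once around the block preserves the sum of the letters. This sum would grow if
  there were no cyclic descent in a nonconstant block, and shrink if every position were
  one.\<close>

lemma card_block_descents:
  assumes "\<not> constant_on_block i \<alpha>"
  shows "0 < card (block_descents i \<alpha>)" "card (block_descents i \<alpha>) < d"
proof -
  let ?B = "position_block i"
  obtain p where p: "p \<in> ?B" "\<alpha> (block_next d p) \<noteq> \<alpha> p" using assms by (auto simp: constant_on_block_def)
  have sum: "(\<Sum>p\<in>?B. \<alpha> (block_next d p)) = (\<Sum>p\<in>?B. \<alpha> p)"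
    by (rule sum.reindex_bij_betw[OF bij_betw_block_next])
  have "block_descents i \<alpha> \<noteq> {}"
  proof
    assume "block_descents i \<alpha> = {}"
    then have "\<forall>q\<in>?B. \<alpha> q \<le> \<alpha> (block_next d q)" by (auto simp: block_descents_def not_less)
    moreover from this p have "\<exists>q\<in>?B. \<alpha> q < \<alpha> (block_next d q)" by (intro bexI[of _ p]) (auto simp: le_less)
    ultimately have "(\<Sum>p\<in>?B. \<alpha> p) < (\<Sum>p\<in>?B. \<alpha> (block_next d p))"
      by (intro sum_strict_mono_ex1) auto
    with sum show False by simp
  qed
  then show "0 < card (block_descents i \<alpha>)" by (simp add: card_gt_0_iff block_descents_def)
  have "block_descents i \<alpha> \<noteq> ?B"
  proof
    assume eq: "block_descents i \<alpha> = ?B"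
    have "(\<Sum>p\<in>?B. \<alpha> (block_next d p)) < (\<Sum>p\<in>?B. \<alpha> p)"
      using p eq by (intro sum_strict_mono) (auto simp: block_descents_def)
    with sum show False by simp
  qed
  then have "card (block_descents i \<alpha>) < card ?B"
    by (intro psubset_card_mono) (auto simp: block_descents_def)
  also have "card ?B \<le> card {i * d + 1..i * d + d}"
  proof (rule card_mono)
    show "?B \<subseteq> {i * d + 1..i * d + d}"
    proof
      fix p assume p: "p \<in> ?B"
      have "i * d \<le> p - 1" "p - 1 < i * d + d"
        using p d div_times_less_eq_dividend[of "p - 1" d] dividend_less_div_times[of d "p - 1"]
        by (auto simp: position_block_def)
      moreover have "1 \<le> p" using p by (simp add: position_block_def)
      ultimately show "p \<in> {i * d + 1..i * d + d}" by auto
    qed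
  qed simp
  finally show "card (block_descents i \<alpha>) < d" by simp
qed

lemma sum_power_des_eq_card:
  fixes \<zeta> :: complex and X :: "((nat \<Rightarrow> nat) \<times> 'f) set"
  assumes \<zeta>: "\<And>c. \<zeta> ^ c = 1 \<longleftrightarrow> d dvd c"
    and "finite X" and closed: "\<And>\<alpha> f \<pi>. (\<alpha>, f) \<in> X \<Longrightarrow> \<pi> permutes {1..n} \<Longrightarrow> (\<alpha> \<circ> \<pi>, f) \<in> X"
  shows "(\<Sum>x\<in>X. \<zeta> ^ \<Sum>(des n (fst x))) = of_nat (card {x \<in> X. \<forall>p\<in>{1..n}. fst x (block_next d p) = fst x p})"
proof -
  let ?w = "\<lambda>x. \<zeta> ^ \<Sum>(des n (fst x))"
  have d1: "\<zeta> ^ d = 1" using \<zeta> by simp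
  \<comment> \<open>The blocks are treated one at a time: codes constant on blocks below
    \<open>m\<close> but not on block \<open>m\<close> cancel under rotation of block
    \<open>m\<close>.\<close>
  define Y where "Y m = {x \<in> X. \<forall>i<m. constant_on_block i (fst x)}" for m
  have finY: "finite (Y m)" for m using assms(2) by (simp add: Y_def)
  have Y: "(\<Sum>x\<in>X. ?w x) = (\<Sum>x\<in>Y m. ?w x)" for m
  proof (induction m)
    case 0
    then show ?case by (simp add: Y_def)
  next
    case (Suc m)
    let ?Z = "{x \<in> Y m. \<not> constant_on_block m (fst x)}"
    let ?\<rho> = "\<lambda>x. (fst x \<circ> rotate_block m, snd x)"
    have "(\<Sum>x\<in>?Z. ?w x) = 0"
    proof (rule sum_eq_0_of_twisted_permutation)
      show "finite ?Z" using finY by simp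
      show "inj_on ?\<rho> ?Z"
      proof (rule inj_onI)
        fix x y assume "?\<rho> x = ?\<rho> y"
        then have eq: "fst x \<circ> rotate_block m = fst y \<circ> rotate_block m" "snd x = snd y" by auto
        have "fst x = fst y"
          using eq(1) permutes_surj[OF rotate_block_permutes[of m]] by (metis surj_fun_eq)
        with eq(2) show "x = y" by (simp add: prod_eq_iff)
      qed
      show "?\<rho> ` ?Z \<subseteq> ?Z"
        using closed rotate_block_permutes by (auto simp: Y_def constant_on_block_rotate)
      fix x assume x: "x \<in> ?Z"
      show "?w (?\<rho> x) * \<zeta> ^ card (block_descents m (fst x)) = ?w x"
        using power_sum_des_rotate[OF d1] by simp
      show "\<zeta> ^ card (block_descents m (fst (?\<rho> x))) = \<zeta> ^ card (block_descents m (fst x))"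
        by (simp only: fst_conv block_descents_rotate)
      have "\<not> d dvd card (block_descents m (fst x))"
        using card_block_descents[of m "fst x"] x by (auto dest: dvd_imp_le)
      then show "\<zeta> ^ card (block_descents m (fst x)) \<noteq> 1" using \<zeta> by simp
    qed
    moreover have "(\<Sum>x\<in>Y m. ?w x) = (\<Sum>x\<in>Y (Suc m). ?w x) + (\<Sum>x\<in>?Z. ?w x)"
    proof -
      have "Y m = Y (Suc m) \<union> ?Z" "Y (Suc m) \<inter> ?Z = {}" by (auto simp: Y_def less_Suc_eq)
      then show ?thesis using finY[of m] finY[of "Suc m"] by (simp add: sum.union_disjoint[symmetric])
    qed
    ultimately show ?case using Suc.IH by simp
  qed
  have fixed: "Y n = {x \<in> X. \<forall>p\<in>{1..n}. fst x (block_next d p) = fst x p}"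
  proof -
    \<comment> \<open>All block indices are below \<open>n\<close>, so \<open>Y n\<close> imposes
      constancy on every block.\<close>
    have "(p - 1) div d < n" if "p \<in> {1..n}" for p
      using that by (intro order_le_less_trans[OF div_le_dividend]) auto
    then have "(\<forall>i<n. constant_on_block i \<alpha>) \<longleftrightarrow> (\<forall>p\<in>{1..n}. \<alpha> (block_next d p) = \<alpha> p)" for \<alpha>
      unfolding constant_on_block_def position_block_def by blast
    then show ?thesis by (simp only: Y_def)
  qed
  have "?w x = 1" if "x \<in> Y n" for x
    unfolding power_sum_des[OF d1] using that by (intro prod.neutral) (auto simp: fixed)
  then show ?thesis using Y[of n] by (simp add: fixed)
qed

end

section \<open>The action of the cyclic group\<close>

lemma Code_comp_permutation:
  assumes "(\<alpha>, f) \<in> Code n j" and \<pi>: "\<pi> permutes {1..n}"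
  shows "(\<alpha> \<circ> \<pi>, f) \<in> Code n j"
proof -
  have max: "max_letter n (\<alpha> \<circ> \<pi>) = max_letter n \<alpha>"
    unfolding max_letter_def image_comp[symmetric] permutes_image[OF \<pi>] ..
  have card: "card (occurrences n (\<alpha> \<circ> \<pi>) k) = card (occurrences n \<alpha> k)" for k
  proof -
    have "occurrences n \<alpha> k = \<pi> ` occurrences n (\<alpha> \<circ> \<pi>) k"
    proof (intro equalityI subsetI)
      fix i assume i: "i \<in> occurrences n \<alpha> k"
      then have "i \<in> \<pi> ` {1..n}" by (simp only: permutes_image[OF \<pi>] occurrences_def mem_Collect_eq)
      then show "i \<in> \<pi> ` occurrences n (\<alpha> \<circ> \<pi>) k" using i by (auto simp: occurrences_def)
    next
      fix i assume "i \<in> \<pi> ` occurrences n (\<alpha> \<circ> \<pi>) k"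
      then show "i \<in> occurrences n \<alpha> k"
        using permutes_in_image[OF \<pi>] by (auto simp: occurrences_def)
    qed
    then show ?thesis using permutes_inj[OF \<pi>] by (simp add: card_image inj_on_subset[OF _ subset_UNIV])
  qed
  have "(\<alpha> \<circ> \<pi>) i = undefined" if "\<alpha> \<in> {1..n} \<rightarrow>\<^sub>E UNIV" "i \<notin> {1..n}" for i
    using that permutes_not_in[OF \<pi>] by (auto simp: PiE_def extensional_def)
  then show ?thesis using assms(1)
    by (simp add: Code_def stembridge_codes_def code_index_def max card PiE_iff extensional_def)
qed

section \<open>The long cycle and the group it generates\<close>

lemma long_cycle_permutes: "long_cycle n permutes {1..n}"
  using cycle_permutes[of "[1..<Suc n]"] by (simp only: long_cycle_def set_upt atLeastLessThanSuc_atLeastAtMost)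

lemma long_cycle_funpow:
  assumes "p \<in> {1..n}"
  shows "(long_cycle n ^^ r) p = Suc ((p - 1 + r) mod n)"
proof -
  let ?cs = "[1..<Suc n]"
  have len: "length ?cs = n" by (simp del: upt_Suc)
  have nth: "?cs ! i = Suc i" if "i < n" for i using that by (simp del: upt_Suc)
  have p: "p - 1 < n" "Suc (p - 1) = p" using assms by auto
  have "(long_cycle n ^^ r) (?cs ! (p - 1)) = rotate r ?cs ! (p - 1)"
    using cyclic_rotation[of ?cs r] p(1) len unfolding long_cycle_def by (metis distinct_upt nth_map)
  also have "\<dots> = ?cs ! ((r + (p - 1)) mod n)"
    using p(1) by (subst nth_rotate) (simp_all only: len)
  also have "\<dots> = Suc ((p - 1 + r) mod n)"
    using p(1) by (subst nth) (auto simp: add.commute)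
  finally show ?thesis using p by (simp only: nth)
qed

lemma sym_group_pow: "x [^]\<^bsub>sym_group n\<^esub> (r::nat) = x ^^ r"
  by (induction r) (simp_all add: sym_group_one sym_group_mult nat_pow_def funpow_Suc_right del: funpow.simps(2))

lemma cycle_group_pow: "x [^]\<^bsub>cycle_group n\<^esub> (r::nat) = x ^^ r"
  unfolding cycle_group_def pow_subgroup_generated by (rule sym_group_pow)

lemma group_cycle_group: "group (cycle_group n)"
  unfolding cycle_group_def by (rule group.group_subgroup_generated[OF sym_group_is_group])

lemma long_cycle_in_sym_group: "long_cycle n \<in> carrier (sym_group n)"
  by (simp only: sym_group_carrier long_cycle_permutes)

lemma finite_sym_group: "finite (carrier (sym_group n))"
  using finite_permutations[of "{1..n}"] by (simp add: sym_group_def)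

lemma carrier_cycle_group: "carrier (cycle_group n) = generate (sym_group n) {long_cycle n}"
  unfolding cycle_group_def carrier_subgroup_generated using long_cycle_in_sym_group by (simp add: Int_absorb1)

lemma long_cycle_funpow_n: "long_cycle n ^^ n = id"
proof
  fix p
  show "(long_cycle n ^^ n) p = id p"
  proof (cases "p \<in> {1..n}")
    case True
    have "(p - 1 + n) mod n = p - 1" using True by (subst mod_add_self2, intro mod_less) auto
    then show ?thesis using True by (simp only: long_cycle_funpow[OF True]) simp
  next
    case False
    then show ?thesis using permutes_not_in[OF permutes_funpow[OF long_cycle_permutes]] by simp
  qed
qed

lemma carrier_cycle_group_eq:
  assumes "1 \<le> n"
  shows "carrier (cycle_group n) = (\<lambda>r. long_cycle n ^^ r) ` {..<n}"
proof -
  interpret group "sym_group n" by (rule sym_group_is_group)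
  note c = long_cycle_in_sym_group[of n]
  have nat: "long_cycle n [^]\<^bsub>sym_group n\<^esub> int r = long_cycle n ^^ r" for r
    by (simp add: int_pow_int sym_group_pow)
  have "long_cycle n [^]\<^bsub>sym_group n\<^esub> k = long_cycle n ^^ nat (k mod int n)" for k :: int
  proof -
    have "long_cycle n [^]\<^bsub>sym_group n\<^esub> (int n * (k div int n) + k mod int n) =
        (long_cycle n [^]\<^bsub>sym_group n\<^esub> int n) [^]\<^bsub>sym_group n\<^esub> (k div int n) \<otimes>\<^bsub>sym_group n\<^esub> long_cycle n [^]\<^bsub>sym_group n\<^esub> (k mod int n)"
      using c by (simp only: int_pow_mult int_pow_pow)
    also have "long_cycle n [^]\<^bsub>sym_group n\<^esub> int n = \<one>\<^bsub>sym_group n\<^esub>"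
      by (simp add: nat long_cycle_funpow_n sym_group_one)
    also have "\<one>\<^bsub>sym_group n\<^esub> [^]\<^bsub>sym_group n\<^esub> (k div int n) = \<one>\<^bsub>sym_group n\<^esub>"
      by (rule int_pow_one)
    also have "long_cycle n [^]\<^bsub>sym_group n\<^esub> (k mod int n) = long_cycle n ^^ nat (k mod int n)"
      using nat[of "nat (k mod int n)"] assms by simp
    finally show ?thesis by (simp add: sym_group_mult sym_group_one)
  qed
  then have "carrier (cycle_group n) = range (\<lambda>k::int. long_cycle n ^^ nat (k mod int n))"
    unfolding carrier_cycle_group generate_pow[OF c] by auto
  also have "\<dots> = (\<lambda>r. long_cycle n ^^ r) ` {..<n}"
  proof (intro equalityI subsetI)
    fix x assume "x \<in> range (\<lambda>k::int. long_cycle n ^^ nat (k mod int n))"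
    then obtain k :: int where "x = long_cycle n ^^ nat (k mod int n)" by blast
    moreover have "nat (k mod int n) < n" using assms by (simp add: nat_less_iff)
    ultimately show "x \<in> (\<lambda>r. long_cycle n ^^ r) ` {..<n}" by blast
  next
    fix x assume "x \<in> (\<lambda>r. long_cycle n ^^ r) ` {..<n}"
    then obtain r where "r < n" "x = long_cycle n ^^ r" by blast
    then show "x \<in> range (\<lambda>k::int. long_cycle n ^^ nat (k mod int n))"
      by (intro image_eqI[of _ _ "int r"]) simp_all
  qed
  finally show ?thesis .
qed

lemma order_cycle_group:
  assumes "1 \<le> n"
  shows "order (cycle_group n) = n"
proof -
  have "inj_on (\<lambda>r. long_cycle n ^^ r) {..<n}"
  proof (rule inj_onI)
    fix r s assume "r \<in> {..<n}" "s \<in> {..<n}" "long_cycle n ^^ r = long_cycle n ^^ s"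
    then show "r = s" using long_cycle_funpow[of 1 n r] long_cycle_funpow[of 1 n s] assms by simp
  qed
  then show ?thesis
    by (simp add: order_def carrier_cycle_group_eq[OF assms] card_image)
qed

lemma group_action_Code:
  assumes "1 \<le> n"
  shows "group_action (cycle_group n) (Code n j) (code_action n j)"
proof -
  let ?X = "Code n j"
  have perm: "\<sigma> permutes {1..n}" if "\<sigma> \<in> carrier (cycle_group n)" for \<sigma>
    using that permutes_funpow[OF long_cycle_permutes] by (auto simp: carrier_cycle_group_eq[OF assms])
  have maps: "code_action n j \<sigma> x \<in> ?X" if "\<sigma> permutes {1..n}" "x \<in> ?X" for \<sigma> x
    using that Code_comp_permutation by (cases x) (auto simp: code_action_def)
  have inv: "code_action n j \<tau> (code_action n j \<sigma> x) = x"
    if "\<sigma> permutes {1..n}" "\<tau> permutes {1..n}" "\<sigma> \<circ> \<tau> = id" "x \<in> ?X" for \<sigma> \<tau> x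
    using that Code_comp_permutation by (cases x) (auto simp: code_action_def comp_assoc)
  have Bij: "code_action n j \<sigma> \<in> Bij ?X" if "\<sigma> \<in> carrier (cycle_group n)" for \<sigma>
  proof -
    note \<sigma> = perm[OF that]
    note \<tau> = permutes_inv[OF \<sigma>]
    have "bij_betw (code_action n j \<sigma>) ?X ?X"
      using maps[OF \<sigma>] maps[OF \<tau>] inv[OF \<sigma> \<tau>] inv[OF \<tau> \<sigma>] permutes_inv_o[OF \<sigma>]
      by (intro bij_betwI[where g = "code_action n j (inv_into UNIV \<sigma>)"]) auto
    then show ?thesis by (simp add: Bij_def code_action_def)
  qed
  have mult: "code_action n j (\<sigma> \<circ> \<tau>) = compose ?X (code_action n j \<sigma>) (code_action n j \<tau>)"
    if "\<sigma> \<in> carrier (cycle_group n)" "\<tau> \<in> carrier (cycle_group n)" for \<sigma> \<tau>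
  proof -
    \<comment> \<open>Composition on the right reverses products; commutativity of the cyclic group
      makes it a left action.\<close>
    have "\<sigma> \<circ> \<tau> = \<tau> \<circ> \<sigma>"
      using that by (auto simp: carrier_cycle_group_eq[OF assms] funpow_add[symmetric] add.commute)
    then show ?thesis
      using Code_comp_permutation[OF _ perm[OF that(2)]]
      by (fastforce simp: code_action_def compose_def restrict_def fun_eq_iff)
  qed
  show ?thesis
    unfolding group_action_def group_hom_def group_hom_axioms_def
    using group_cycle_group group_BijGroup Bij mult
    by (auto simp: hom_def BijGroup_def cycle_group_def sym_group_mult)
qed

section \<open>Codes fixed by a power of the long cycle\<close>

context
  fixes n r d :: nat
  assumes n: "1 \<le> n" and d_def: "d = n div gcd n r"
begin

lemma n_eq_gcd_mult: "n = gcd n r * d" and r_eq_gcd_mult: "r = gcd n r * (r div gcd n r)"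
  by (simp_all add: d_def)

lemma coprime_d: "coprime (r div gcd n r) d"
  using div_gcd_coprime[of n r] n by (simp add: d_def coprime_commute)

lemma d_ge_1: "1 \<le> d"
  using n n_eq_gcd_mult by (cases d) auto

text \<open>Conjugates the blockwise cyclic successor into the \<open>r\<close>-th power of the long cycle.\<close>

definition interleave :: "nat \<Rightarrow> nat" where
  "interleave p = (if p \<in> {1..n} then Suc (((p - 1) div d + ((p - 1) mod d) * r) mod n) else p)"

lemma interleave_in: "p \<in> {1..n} \<Longrightarrow> interleave p \<in> {1..n}"
  using n by (simp add: interleave_def Suc_le_eq)

text \<open>Modulo \<open>gcd n r\<close> the multiple of \<open>r\<close> vanishes, which recovers
  the block index below \<open>gcd n r\<close>. Dividing the rest by the gcd and using that
  \<open>r div gcd n r\<close> is coprime to \<open>d\<close> recovers the offset below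
  \<open>d\<close>.\<close>

lemma interleave_permutes: "interleave permutes {1..n}"
proof (rule bij_imp_permutes)
  have "inj_on interleave {1..n}"
  proof (rule inj_onI)
    fix p q assume pq: "p \<in> {1..n}" "q \<in> {1..n}" "interleave p = interleave q"
    let ?a = "(p - 1) div d" and ?b = "(q - 1) div d" and ?k = "(p - 1) mod d" and ?l = "(q - 1) mod d"
    have cong: "[?a + ?k * r = ?b + ?l * r] (mod n)"
      using pq by (simp add: interleave_def cong_def)
    have "[?a + ?k * r = ?b + ?l * r] (mod gcd n r)"
      using cong by (rule cong_dvd_modulus_nat) simp
    moreover have "[?a + ?k * r = ?a] (mod gcd n r)" "[?b + ?l * r = ?b] (mod gcd n r)"
      by (simp_all add: cong_def mod_eq_0_iff_dvd mod_add_right_eq[symmetric] flip: mod_add_right_eq)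
    ultimately have "[?a = ?b] (mod gcd n r)"
      by (meson cong_sym cong_trans)
    moreover have "?a < gcd n r" "?b < gcd n r"
      using pq n_eq_gcd_mult by (auto intro!: less_mult_imp_div_less)
    ultimately have ab: "?a = ?b" by (simp add: cong_def)
    with cong have "[?k * r = ?l * r] (mod n)" by (simp add: cong_add_lcancel_nat)
    moreover have "x * r = gcd n r * (x * (r div gcd n r))" for x
      by (subst r_eq_gcd_mult) (rule mult.left_commute)
    ultimately have "gcd n r * (?k * (r div gcd n r)) mod (gcd n r * d) = gcd n r * (?l * (r div gcd n r)) mod (gcd n r * d)"
      by (simp only: cong_def n_eq_gcd_mult[symmetric])
    then have "[?k * (r div gcd n r) = ?l * (r div gcd n r)] (mod d)"
      using n by (simp add: cong_def mod_mult_mult1)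
    then have "[?k = ?l] (mod d)" using coprime_d by (simp add: cong_mult_rcancel_nat)
    then have "?k = ?l" by (simp add: cong_def)
    with ab have "p - 1 = q - 1" by (metis div_mult_mod_eq)
    with pq show "p = q" by auto
  qed
  moreover have "interleave ` {1..n} \<subseteq> {1..n}" using interleave_in by blast
  ultimately show "bij_betw interleave {1..n} {1..n}"
    by (simp add: bij_betw_def endo_inj_surj)
qed (auto simp: interleave_def)

lemma d_dvd: "d dvd n"
  using n_eq_gcd_mult by (metis dvd_triv_right)

text \<open>One step inside a block adds \<open>r\<close> to the image modulo \<open>n\<close>. At
  the end of the block the cycle closes, since \<open>n\<close> divides
  \<open>d * r\<close>.\<close>

lemma interleave_block_next:
  assumes p: "p \<in> {1..n}"
  shows "interleave (block_next d p) = (long_cycle n ^^ r) (interleave p)"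
proof -
  let ?k = "(p - 1) div d" and ?s = "(p - 1) mod d"
  have next_in: "block_next d p \<in> {1..n}"
    using p block_next(1)[OF d_ge_1, of p] block_next_le[OF d_ge_1 d_dvd, of p] by auto
  have next_div: "(block_next d p - 1) div d = ?k" using p block_next(2)[OF d_ge_1, of p] by simp
  have rhs: "(long_cycle n ^^ r) (interleave p) = Suc ((?k + Suc ?s * r) mod n)"
  proof -
    have "interleave p - 1 = (?k + ?s * r) mod n" using p by (simp add: interleave_def)
    then have "(interleave p - 1 + r) mod n = (?k + ?s * r + r) mod n" by (simp only: mod_add_left_eq)
    also have "?k + ?s * r + r = ?k + Suc ?s * r" by simp
    finally show ?thesis by (simp only: long_cycle_funpow[OF interleave_in[OF p]])
  qed
  show ?thesis
  proof (cases "d dvd p")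
    case True
    then obtain m where m: "p = d * Suc m" using p by (metis atLeastAtMost_iff dvdE mult_0_right not0_implies_Suc not_one_le_zero)
    have "p - 1 = (d - 1) + d * m" using m d_ge_1 by simp
    then have "?s = (d - 1) mod d" by (simp only: mod_mult_self2)
    then have s: "Suc ?s = d" using d_ge_1 by simp
    have "(block_next d p - 1) mod d = 0" using True m by (simp add: block_next_def)
    then have "interleave (block_next d p) = Suc (?k mod n)"
      using next_in next_div by (simp add: interleave_def)
    moreover have "n dvd d * r" by (subst n_eq_gcd_mult) (simp add: mult.commute)
    ultimately show ?thesis unfolding rhs s by (auto elim!: dvdE)
  next
    case False
    have "(block_next d p - 1) mod d = Suc ?s"
    proof -
      have "block_next d p - 1 = Suc (p - 1)" using False p by (simp add: block_next_def)
      moreover have "Suc (p - 1) mod d \<noteq> 0" using False p by (simp add: dvd_eq_mod_eq_0)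
      ultimately show ?thesis by (simp add: mod_Suc split: if_splits)
    qed
    then show ?thesis
      unfolding rhs using next_in next_div by (simp add: interleave_def)
  qed
qed

text \<open>Composition with \<open>interleave\<close> carries invariance under the power of the
  long cycle to constancy on blocks; its inverse gives the way back.\<close>

lemma card_fixed_codes:
  "card {x \<in> Code n j. fst x \<circ> (long_cycle n ^^ r) = fst x} =
   card {x \<in> Code n j. \<forall>p\<in>{1..n}. fst x (block_next d p) = fst x p}"
proof -
  note inv = permutes_inv[OF interleave_permutes]
  let ?\<theta>' = "inv_into UNIV interleave"
  have "bij_betw (\<lambda>x. (fst x \<circ> interleave, snd x)) {x \<in> Code n j. fst x \<circ> (long_cycle n ^^ r) = fst x}
     {x \<in> Code n j. \<forall>p\<in>{1..n}. fst x (block_next d p) = fst x p}"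
  proof (rule bij_betwI[where g = "\<lambda>x. (fst x \<circ> ?\<theta>', snd x)"])
    show "(\<lambda>x. (fst x \<circ> interleave, snd x)) \<in> {x \<in> Code n j. fst x \<circ> (long_cycle n ^^ r) = fst x} \<rightarrow>
      {x \<in> Code n j. \<forall>p\<in>{1..n}. fst x (block_next d p) = fst x p}"
    proof (safe, goal_cases)
      case (1 \<alpha> f)
      then show ?case using Code_comp_permutation[OF _ interleave_permutes] by simp
    next
      case (2 \<alpha> f p)
      then have "(\<alpha> \<circ> (long_cycle n ^^ r)) (interleave p) = \<alpha> (interleave p)" by simp
      then show ?case using interleave_block_next[OF 2(3)] by simp
    qed
    show "(\<lambda>x. (fst x \<circ> ?\<theta>', snd x)) \<in> {x \<in> Code n j. \<forall>p\<in>{1..n}. fst x (block_next d p) = fst x p} \<rightarrow>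
      {x \<in> Code n j. fst x \<circ> (long_cycle n ^^ r) = fst x}"
    proof (safe, goal_cases)
      case (1 \<alpha> f)
      then show ?case using Code_comp_permutation[OF _ inv] by simp
    next
      case (2 \<alpha> f)
      show ?case
      proof
        fix p
        show "(fst (fst (\<alpha>, f) \<circ> ?\<theta>', snd (\<alpha>, f)) \<circ> long_cycle n ^^ r) p = fst (fst (\<alpha>, f) \<circ> ?\<theta>', snd (\<alpha>, f)) p"
        proof (cases "p \<in> {1..n}")
          case True
          define q where "q = ?\<theta>' p"
          have q: "q \<in> {1..n}" "p = interleave q"
            using True permutes_in_image[OF inv] permutes_inverses[OF interleave_permutes] by (auto simp only: q_def)
          have "\<alpha> (block_next d q) = \<alpha> q" using 2(2) q(1) by simp
          then show ?thesis
            using permutes_inverses[OF interleave_permutes]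
            by (simp add: q(2) interleave_block_next[OF q(1), symmetric])
        next
          case False
          then show ?thesis using permutes_not_in[OF permutes_funpow[OF long_cycle_permutes]] by simp
        qed
      qed
    qed
  qed (use permutes_inv_o[OF interleave_permutes] in \<open>simp_all add: comp_assoc\<close>)
  then show ?thesis by (rule bij_betw_same_card)
qed

text \<open>The evaluation point is a primitive \<open>d\<close>-th root of unity: cancel the gcd in
  \<open>n dvd r * c\<close> and use coprimality.\<close>

lemma root_of_unity_power_eq_1_iff:
  "(exp (2 * of_real pi * \<i> / of_nat n) ^ r) ^ c = (1::complex) \<longleftrightarrow> d dvd c"
proof -
  have "(exp (2 * of_real pi * \<i> / of_nat n) ^ r) ^ c = exp (2 * of_real pi * \<i> * of_nat (r * c) / of_nat n)"
    unfolding power_mult[symmetric] exp_of_nat_mult[symmetric] by (simp add: mult_ac)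
  also have "\<dots> = 1 \<longleftrightarrow> n dvd r * c"
    by (rule complex_root_unity_eq_1[OF n])
  also have "\<dots> \<longleftrightarrow> gcd n r * d dvd gcd n r * (r div gcd n r * c)"
    using n_eq_gcd_mult r_eq_gcd_mult by (simp add: mult.assoc[symmetric])
  also have "\<dots> \<longleftrightarrow> d dvd c"
    using n coprime_d by (simp add: coprime_dvd_mult_right_iff coprime_commute)
  finally show ?thesis .
qed

end

lemma poly_map_poly_sum_monom:
  "poly (map_poly of_nat (\<Sum>x\<in>X. monom (1::nat) (h x))) (z::complex) = (\<Sum>x\<in>X. z ^ h x)"
proof -
  have "map_poly of_nat (\<Sum>x\<in>X. monom (1::nat) (h x)) = (\<Sum>x\<in>X. monom (1::complex) (h x))"
    by (rule poly_eqI) (simp add: coeff_map_poly coeff_sum of_nat_sum if_distrib cong: if_cong)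
  then show ?thesis by (simp add: poly_sum poly_monom)
qed

theorem theorem6p26:
  fixes n j :: nat
  assumes "1 \<le> n" and "j \<le> n - 1"
  shows "cyclic_sieving (cycle_group n) (long_cycle n) (Code n j) (code_action n j)
           (q_Eulerian_coeff n j)"
proof -
  note n = assms(1)
  have fin: "finite (Code n j)"
    using finite_stembridge_codes[OF n] by (simp add: Code_def)
  have "of_nat (card {x \<in> Code n j. code_action n j (long_cycle n [^]\<^bsub>cycle_group n\<^esub> r) x = x}) =
        poly (map_poly of_nat (q_Eulerian_coeff n j)) (exp (2 * of_real pi * \<i> / of_nat (order (cycle_group n))) ^ r :: complex)" for r
  proof -
    define d where "d = n div gcd n r"
    note root = root_of_unity_power_eq_1_iff[OF n d_def]
    have "{x \<in> Code n j. code_action n j (long_cycle n [^]\<^bsub>cycle_group n\<^esub> r) x = x} =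
          {x \<in> Code n j. fst x \<circ> (long_cycle n ^^ r) = fst x}"
      by (auto simp: code_action_def cycle_group_pow)
    then show ?thesis
      using sum_power_des_eq_card[OF d_ge_1[OF n d_def] d_dvd[OF n d_def] root fin Code_comp_permutation]
      by (simp add: card_fixed_codes[OF n d_def] order_cycle_group[OF n] q_Eulerian_coeff_eq_sum_codes[OF n]
          poly_map_poly_sum_monom del: One_nat_def)
  qed
  moreover have "finite (carrier (cycle_group n))"
    using group.carrier_subgroup_generated_subset[OF sym_group_is_group] finite_sym_group
    unfolding cycle_group_def by (rule finite_subset)
  moreover have "long_cycle n \<in> carrier (cycle_group n)"
    unfolding carrier_cycle_group by (rule generate.incl) simp
  moreover have "subgroup_generated (cycle_group n) {long_cycle n} = cycle_group n"
    unfolding cycle_group_def by (rule group.subgroup_generated2[OF sym_group_is_group])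
  ultimately show ?thesis
    unfolding cyclic_sieving_def using fin group_cycle_group group_action_Code[OF n] by blast
qed

end
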